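(* Let $\beta\in(0,1)$, $\lambda<0$ and $u_0>0$. The solution $u$ to $$\partial_0^\beta u(x)=\lambda u(x)\ \text{ for } x>0,\qquad u(0)=u_0,$$ is completely monotone (i.e. $(-1)^nu^{(n)}\ge0$ on $(0,\infty)$ for $n=0,1,2,\dots$), and there exists a constant $C>1$ such that $$\frac{C^{-1}}{x^{1+\beta}}\le u(x)\le\frac{C}{x^{1+\beta}}\quad\text{for all }x\ge1.$$
   Context: Fix $\beta\in(0,1)$. For $0<T<\infty$, $C\cap L^1(0,T]$ is the set of continuous, Lebesgue integrable real functions on $(0,T]$. For $u\in C\cap L^1(0,T]$, $J_0^{1-\beta}u(x)=\int_0^x\frac{(x-r)^{-\beta}}{\Gamma(1-\beta)}u(r)\,dr$. Define $C_\beta(0,T]=\{u\in C\cap L^1(0,T]: J_0^{1-\beta}u\in C^1(0,T]\}$ and $C_\beta[0,T]=C[0,T]\cap C_\beta(0,T]$. For $u\in C_\beta(0,T]$, the censored fractional derivative is $\partial_0^\beta u(x)=\frac{d}{dx}J_0^{1-\beta}u(x)-\frac{x^{-\beta}}{\Gamma(1-\beta)}u(x)$, $x\in(0,T]$. "The solution" is the function $u$ on $[0,\infty)$ whose restriction to $[0,T]$ is, for every $T>0$, the unique element of $C_\beta[0,T]$ solving the problem on $(0,T]$; explicitly, it is $$u(x)=u_0\sum_{N=0}^\infty\lambda^Nx^{\beta N}\prod_{n=1}^N\left(\frac{\Gamma(1+n\beta)}{\Gamma(n\beta+1-\beta)}-\frac{1}{\Gamma(1-\beta)}\right)^{-1}$$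 (empty product equal to $1$). *)

theory Defs
  imports "HOL-Analysis.Analysis"
begin

text \<open>
  Functions on \<open>(0,T]\<close>, \<open>[0,T]\<close> or \<open>[0,\<infinity>)\<close> are represented by total functions on the reals;
  the definitions below only look at their values on the respective domain.
\<close>

text \<open>The Riemann--Liouville integral \<open>J\<^sub>0\<^sup>\<alpha> u\<close>; for \<open>\<alpha> = 1 - \<beta>\<close> the kernel is
  \<open>(x - r)\<^sup>-\<^sup>\<beta> / \<Gamma>(1 - \<beta>)\<close>. For \<open>u\<close> continuous and integrable on \<open>(0,T]\<close> the integrand is
  Lebesgue integrable for every \<open>x\<close> in \<open>(0,T]\<close>.\<close>

definition RL_integral :: "real \<Rightarrow> (real \<Rightarrow> real) \<Rightarrow> real \<Rightarrow> real" where
  "RL_integral \<alpha> u x = (LBINT r:{0<..<x}. (x - r) powr (\<alpha> - 1) / Gamma \<alpha> * u r)"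

definition C_L1 :: "real \<Rightarrow> (real \<Rightarrow> real) set" where
  "C_L1 T = {u. continuous_on {0<..T} u \<and> set_integrable lborel {0<..T} u}"

text \<open>Derivatives on \<open>(0,T]\<close> are taken relative to that interval, i.e. they are one-sided at \<open>T\<close>
  (unlike in the library's \<open>C1_differentiable_on\<close>).\<close>

definition C1_Ioc :: "real \<Rightarrow> (real \<Rightarrow> real) set" where
  "C1_Ioc T = {f. \<exists>f'. continuous_on {0<..T} f' \<and>
     (\<forall>x\<in>{0<..T}. (f has_real_derivative f' x) (at x within {0<..T}))}"

definition C_beta_Ioc :: "real \<Rightarrow> real \<Rightarrow> (real \<Rightarrow> real) set" where
  "C_beta_Ioc \<beta> T = {u \<in> C_L1 T. RL_integral (1 - \<beta>) u \<in> C1_Ioc T}"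

definition C_beta_Icc :: "real \<Rightarrow> real \<Rightarrow> (real \<Rightarrow> real) set" where
  "C_beta_Icc \<beta> T = {u. continuous_on {0..T} u} \<inter> C_beta_Ioc \<beta> T"

definition censored_deriv :: "real \<Rightarrow> real \<Rightarrow> (real \<Rightarrow> real) \<Rightarrow> real \<Rightarrow> real" where
  "censored_deriv \<beta> T u x =
     vector_derivative (RL_integral (1 - \<beta>) u) (at x within {0<..T})
     - x powr (- \<beta>) / Gamma (1 - \<beta>) * u x"

definition solves_on :: "real \<Rightarrow> real \<Rightarrow> real \<Rightarrow> real \<Rightarrow> (real \<Rightarrow> real) \<Rightarrow> bool" where
  "solves_on \<beta> lam u0 T u \<longleftrightarrow>
     u \<in> C_beta_Icc \<beta> T \<and>
     (\<forall>x\<in>{0<..T}. censored_deriv \<beta> T u x = lam * u x) \<and>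
     u 0 = u0"

definition solution :: "real \<Rightarrow> real \<Rightarrow> real \<Rightarrow> (real \<Rightarrow> real) \<Rightarrow> bool" where
  "solution \<beta> lam u0 u \<longleftrightarrow> (\<forall>T>0. solves_on \<beta> lam u0 T u)"

text \<open>The existence of all derivatives is stated explicitly, since \<open>deriv\<close> is total.\<close>

definition completely_monotone :: "(real \<Rightarrow> real) \<Rightarrow> bool" where
  "completely_monotone u \<longleftrightarrow>
     (\<forall>n. \<forall>x>0. (deriv ^^ n) u field_differentiable (at x) \<and> (-1) ^ n * (deriv ^^ n) u x \<ge> 0)"

end

theory Submission
  imports Defs "HOL-Real_Asymp.Real_Asymp"
begin

text \<open>
  On power series in \<open>x\<^sup>\<beta>\<close> the censored derivative, multiplied by \<open>x\<^sup>\<beta>\<close>, is the dilation-invariant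
  operator \<open>L u(x) = \<integral>\<^sub>0\<^sup>1 (u(x) - u(xs)) \<nu>(s) ds\<close> with \<open>\<nu>(s) = \<beta> (1 - s)\<^sup>-\<^sup>1\<^sup>-\<^sup>\<beta> / \<Gamma>(1 - \<beta>)\<close>.
  Inverting the Riemann--Liouville integral turns the equation into a renewal equation with an
  integrable kernel, whose continuous solutions are determined by \<open>u(0)\<close>; hence \<open>u\<close> is \<open>u\<^sub>0\<close> times
  the series solution \<open>F\<close>. Applying \<open>x\<^sup>n \<partial>\<^sup>n\<close> to \<open>L F = \<lambda> x\<^sup>\<beta> F\<close> and using a minimum
  principle for \<open>L\<close> gives complete monotonicity by induction on \<open>n\<close>.
  For the decay, nonnegativity of the Riemann--Liouville integral of \<open>u\<close> forces \<open>\<integral>\<^sub>0\<^sup>\<infinity> u < \<infinity>\<close>,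
  so \<open>u(x) = O(1/x)\<close>, and estimating \<open>L u\<close> from both sides (using convexity near \<open>s = 1\<close>)
  shows that \<open>x\<^sup>\<beta> u(x)\<close> is comparable to \<open>1/x\<close>.
\<close>

subsection \<open>Integrals of powers\<close>

text \<open>For \<open>l < 0\<close> the series alternates, so neither its sign nor its behaviour at
  infinity can be read off termwise; both have to come from the equation
  \<open>L F = l x^b F\<close>. That equation passes to all derivatives since \<open>x^n d^n\<close>
  commutes with dilations, and \<open>x^n F^(n)\<close> extends continuously to 0, so that minima
  over \<open>[0,x]\<close> are attained. Uniqueness is delicate because the renewal kernel is
  critical: at \<open>x = 0\<close> it is the Beta(1-b, b) probability density, of mass exactly 1.
  There is no contraction near 0, and for \<open>l = 0\<close> every constant is a solution. The
  series for \<open>|l|\<close>, which solves a renewal equation with positive kernel, takes the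
  place of a contraction. The decay rate reflects where \<open>L u(x)\<close> gets its size: the
  integral of \<open>u(x s)\<close> over \<open>s\<close> in (0,1) is of order 1/x and sits at small
  \<open>s\<close>, where the density is close to its positive value at 0.\<close>

lemma set_lborel_of_has_integral_nonneg:
  fixes f :: "real \<Rightarrow> real"
  assumes "(f has_integral I) {a..b}" and cont: "continuous_on {a<..<b} f"
    and nonneg: "\<And>x. x \<in> {a<..<b} \<Longrightarrow> 0 \<le> f x"
  shows "set_integrable lborel {a<..<b} f" and "(LBINT x:{a<..<b}. f x) = I"
proof -
  have hi: "(f has_integral I) {a<..<b}"
    using assms(1) by (simp add: has_integral_Icc_iff_Ioo)
  then have "f absolutely_integrable_on {a<..<b}"
    using nonneg by (intro nonnegative_absolutely_integrable_1) (auto simp: integrable_on_def)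
  moreover have "(\<lambda>x. indicator {a<..<b} x *\<^sub>R f x) \<in> borel_measurable borel"
    using cont by (intro borel_measurable_continuous_on_indicator) auto
  ultimately show *: "set_integrable lborel {a<..<b} f"
    unfolding set_integrable_def by (subst (asm) integrable_completion) auto
  show "(LBINT x:{a<..<b}. f x) = I"
    using set_borel_integral_eq_integral(2)[OF *] hi by (simp add: integral_unique)
qed

lemma powr_powr_nat:
  fixes x b :: real
  assumes "0 \<le> x" "0 < x \<or> n \<noteq> 0"
  shows "(x powr b) ^ n = x powr (b * real n)"
  using assms by (cases "x = 0") (auto simp: powr_powr powr_realpow[symmetric])

lemma set_lborel_Beta:
  fixes p q :: real
  assumes "0 < p" "0 < q"
  shows "set_integrable lborel {0<..<1} (\<lambda>s. s powr (p - 1) * (1 - s) powr (q - 1))"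
    and "(LBINT s:{0<..<1}. s powr (p - 1) * (1 - s) powr (q - 1)) = Beta p q"
  by (rule set_lborel_of_has_integral_nonneg[OF has_integral_Beta_real[OF assms]];
      auto intro!: continuous_intros)+

lemma Beta_eq_Gamma_div: "Beta p q = Gamma p * Gamma q / Gamma (p + q)" for p q :: real
  by (simp add: Beta_def)

lemma set_lborel_scale:
  fixes f :: "real \<Rightarrow> real" and c :: real
  assumes c: "0 < c"
  shows "(LBINT r:{t<..<t+c}. f r) = c * (LBINT s:{0<..<1}. f (t + c * s))"
    and "set_integrable lborel {t<..<t+c} f \<longleftrightarrow> set_integrable lborel {0<..<1} (\<lambda>s. f (t + c * s))"
proof -
  have *: "indicator {t<..<t+c} (t + c * s) = (indicator {0<..<1} s :: real)" for s
    using c by (auto simp: indicator_def zero_less_mult_iff)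
  show "(LBINT r:{t<..<t+c}. f r) = c * (LBINT s:{0<..<1}. f (t + c * s))"
    using c unfolding set_lebesgue_integral_def
    by (subst lborel_integral_real_affine[of c _ t]) (auto simp: *)
  show "set_integrable lborel {t<..<t+c} f \<longleftrightarrow> set_integrable lborel {0<..<1} (\<lambda>s. f (t + c * s))"
    using c unfolding set_integrable_def
    by (subst lborel_integrable_real_affine_iff[of c _ t, symmetric]) (auto simp: *)
qed

text \<open>Integration by parts in disguise: \<open>(1 - s^p) (1 - s)^(-b)\<close> has as
  derivative this integrand minus \<open>p\<close> times the Beta integrand. It is 1 at 0 and tends
  to 0 at 1, because \<open>1 - s^p = O(1 - s)\<close> and \<open>b < 1\<close>; hence the
  \<open>- 1\<close>.\<close>

lemma levy_has_integral:
  fixes b p :: real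
  assumes b: "0 < b" "b < 1" and p: "0 < p"
  shows "((\<lambda>s. b * (1 - s) powr (- 1 - b) * (1 - s powr p)) has_integral
           (p * Beta p (1 - b) - 1)) {0..1}"
proof -
  let ?h = "\<lambda>s::real. (1 - s powr p) * (1 - s) powr (- b)"
  have der: "(?h has_vector_derivative
      (b * (1 - s) powr (- 1 - b) * (1 - s powr p) - p * (s powr (p - 1) * (1 - s) powr ((1 - b) - 1)))) (at s)"
    if "s \<in> {0<..<1}" for s
    unfolding has_real_derivative_iff_has_vector_derivative[symmetric] using that
    by (auto intro!: derivative_eq_intros simp: field_simps powr_diff powr_minus)
  have lim: "(?h \<longlongrightarrow> 0) (at_left 1)"
    using b p by real_asymp
  have "continuous (at s within {0..1}) ?h" if "s \<in> {0..1}" for s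
  proof (cases "s = 1")
    case True
    have "at 1 within {0..1} = at_left (1::real)"
      by (rule at_within_Icc_at_left) simp
    then show ?thesis using lim by (simp add: True continuous_within)
  next
    case False
    then have s: "s < 1" using that by auto
    show ?thesis
    proof (cases "s = 0")
      case True
      have "((\<lambda>s. s powr p) \<longlongrightarrow> 0 powr p) (at 0 within {0..1})"
        by (rule tendsto_powr') (use p in \<open>auto simp: eventually_at_filter\<close>)
      moreover have "((\<lambda>s::real. (1 - s) powr (- b)) \<longlongrightarrow> (1 - 0) powr (- b)) (at 0 within {0..1})"
        by (intro tendsto_intros) auto
      ultimately have "(?h \<longlongrightarrow> (1 - 0 powr p) * (1 - 0) powr (- b)) (at 0 within {0..1})"
        by (intro tendsto_mult[OF tendsto_diff[OF tendsto_const]])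
      then show ?thesis
        by (simp add: True continuous_within)
    next
      case False
      then show ?thesis using s that by (intro continuous_intros) auto
    qed
  qed
  then have "continuous_on {0..1} ?h" by (simp add: continuous_on_eq_continuous_within)
  from fundamental_theorem_of_calculus_interior[OF _ this der]
  have "((\<lambda>s. b * (1 - s) powr (- 1 - b) * (1 - s powr p) - p * (s powr (p - 1) * (1 - s) powr ((1 - b) - 1)))
      has_integral (- 1)) {0..1}" using p by simp
  moreover have "((\<lambda>s. p * (s powr (p - 1) * (1 - s) powr ((1 - b) - 1))) has_integral p * Beta p (1 - b)) {0..1}"
    using b p by (intro has_integral_mult_right has_integral_Beta_real) auto
  ultimately show ?thesis
    by (auto dest: has_integral_add)
qed

lemma set_lborel_levy:
  fixes b p :: real
  assumes b: "0 < b" "b < 1" and p: "0 < p"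
  shows "set_integrable lborel {0<..<1} (\<lambda>s. b * (1 - s) powr (- 1 - b) * (1 - s powr p))"
    and "(LBINT s:{0<..<1}. b * (1 - s) powr (- 1 - b) * (1 - s powr p)) = p * Beta p (1 - b) - 1"
proof -
  have c: "continuous_on {0<..<1} (\<lambda>s. b * (1 - s) powr (- 1 - b) * (1 - s powr p))"
    by (intro continuous_intros) auto
  have n: "0 \<le> b * (1 - s) powr (- 1 - b) * (1 - s powr p)" if "s \<in> {0<..<1}" for s
    using that b p by (intro mult_nonneg_nonneg) (auto simp: powr_le1)
  show "set_integrable lborel {0<..<1} (\<lambda>s. b * (1 - s) powr (- 1 - b) * (1 - s powr p))"
    and "(LBINT s:{0<..<1}. b * (1 - s) powr (- 1 - b) * (1 - s powr p)) = p * Beta p (1 - b) - 1"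
    using set_lborel_of_has_integral_nonneg[OF levy_has_integral[OF assms] c n] by blast+
qed

text \<open>Since the \<open>h N\<close> are nonnegative, the L1 norms of the terms are
  \<open>|a N|\<close> times their integrals, so the summability hypotheses are exactly what
  termwise integration asks for.\<close>

lemma set_lborel_termwise:
  fixes h :: "nat \<Rightarrow> real \<Rightarrow> real" and a :: "nat \<Rightarrow> real"
  assumes int: "\<And>N. set_integrable lborel A (h N)"
    and nonneg: "\<And>N s. s \<in> A \<Longrightarrow> 0 \<le> h N s"
    and summ: "summable (\<lambda>N. \<bar>a N\<bar> * (LBINT s:A. h N s))"
    and pt: "\<And>s. s \<in> A \<Longrightarrow> summable (\<lambda>N. \<bar>a N\<bar> * h N s)"
  shows "set_integrable lborel A (\<lambda>s. \<Sum>N. a N * h N s)"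
    and "(LBINT s:A. (\<Sum>N. a N * h N s)) = (\<Sum>N. a N * (LBINT s:A. h N s))"
proof -
  let ?f = "\<lambda>N s. a N * (indicator A s * h N s)"
  have I: "integrable lborel (?f N)" for N
    using int[of N] unfolding set_integrable_def by simp
  have nf: "norm (?f N s) = \<bar>a N\<bar> * (indicator A s * h N s)" for N s
    using nonneg[of s N] by (auto simp: abs_mult indicator_def)
  have N: "(\<integral>s. norm (?f N s) \<partial>lborel) = \<bar>a N\<bar> * (LBINT s:A. h N s)" for N
    unfolding nf by (simp add: set_lebesgue_integral_def)
  have ae: "AE s in lborel. summable (\<lambda>N. norm (?f N s))"
    unfolding nf using pt by (intro AE_I2) (auto simp: indicator_def)
  have sum: "summable (\<lambda>N. \<integral>s. norm (?f N s) \<partial>lborel)"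
    unfolding N by (rule summ)
  have eq: "(\<Sum>N. ?f N s) = indicator A s *\<^sub>R (\<Sum>N. a N * h N s)" for s
    by (auto simp: indicator_def)
  show "set_integrable lborel A (\<lambda>s. \<Sum>N. a N * h N s)"
    using integrable_suminf[OF I ae sum] unfolding set_integrable_def eq .
  show "(LBINT s:A. (\<Sum>N. a N * h N s)) = (\<Sum>N. a N * (LBINT s:A. h N s))"
    using integral_suminf[OF I ae sum] unfolding set_lebesgue_integral_def eq by simp
qed

subsection \<open>The coefficients of the series\<close>

text \<open>The censored derivative maps \<open>x\<^sup>\<beta>\<^sup>N\<close> to \<open>eigenvalue \<beta> N\<close> times \<open>x\<^sup>\<beta>\<^sup>(\<^sup>N\<^sup>-\<^sup>1\<^sup>)\<close>.\<close>

definition eigenvalue :: "real \<Rightarrow> nat \<Rightarrow> real" where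
  "eigenvalue b N = Gamma (1 + b * real N) / Gamma (b * real N + 1 - b) - 1 / Gamma (1 - b)"

definition levy_density :: "real \<Rightarrow> real \<Rightarrow> real" where
  "levy_density b s = b / Gamma (1 - b) * (1 - s) powr (- 1 - b)"

definition sol_coeff :: "real \<Rightarrow> real \<Rightarrow> nat \<Rightarrow> real" where
  "sol_coeff b l N = (\<Prod>n=1..N. l / eigenvalue b n)"

text \<open>Natural powers of \<open>x powr b\<close> make this an ordinary power series in
  \<open>z = x^b\<close>, and they give the value 1 to the term \<open>N = 0\<close> at
  \<open>x = 0\<close>, where \<open>0 powr 0\<close> would be 0.\<close>

definition sol_series :: "real \<Rightarrow> real \<Rightarrow> real \<Rightarrow> real" where
  "sol_series b l x = (\<Sum>N. sol_coeff b l N * (x powr b) ^ N)"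

lemma eigenvalue_0 [simp]: "eigenvalue b 0 = 0"
  by (simp add: eigenvalue_def)

lemma sol_coeff_0 [simp]: "sol_coeff b l 0 = 1"
  by (simp add: sol_coeff_def)

section \<open>Coefficient sequences of everywhere convergent power series\<close>

definition entire :: "(nat \<Rightarrow> real) \<Rightarrow> bool" where
  "entire a \<longleftrightarrow> (\<forall>z. summable (\<lambda>N. a N * z ^ N))"

lemma entire_abs:
  assumes "entire a"
  shows "summable (\<lambda>N. \<bar>a N\<bar> * \<bar>z\<bar> ^ N)"
proof -
  have "summable (\<lambda>N. norm (a N * \<bar>z\<bar> ^ N))"
    by (rule powser_insidea[of _ "\<bar>z\<bar> + 1"]) (use assms in \<open>auto simp: entire_def\<close>)
  then show ?thesis by (simp add: abs_mult power_abs)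
qed

lemma entire_mult_of_nat:
  assumes "entire a"
  shows "entire (\<lambda>N. real N * a N)"
  unfolding entire_def
proof
  fix z :: real
  have "summable (\<lambda>n. diffs a n * z ^ n)"
    by (rule termdiff_converges_all) (use assms in \<open>auto simp: entire_def\<close>)
  then have "summable (\<lambda>n. z * (diffs a n * z ^ n))" by (rule summable_mult)
  then have "summable (\<lambda>n. real (Suc n) * a (Suc n) * z ^ Suc n)"
    by (simp add: diffs_def mult_ac)
  then show "summable (\<lambda>N. real N * a N * z ^ N)"
    by (subst summable_Suc_iff[symmetric])
qed

lemma entire_cmult: "entire a \<Longrightarrow> entire (\<lambda>N. c * a N)"
  using summable_mult[of "\<lambda>N. a N * z ^ N" c for z] by (auto simp: entire_def mult.assoc)

lemma entire_add: "entire a \<Longrightarrow> entire a' \<Longrightarrow> entire (\<lambda>N. a N + a' N)"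
  by (auto simp: entire_def ring_distribs intro: summable_add)

text \<open>Compares slopes of the convex function \<open>ln \<Gamma>\<close> on \<open>[y - 1, y]\<close> and \<open>[y, y + b]\<close>.\<close>

lemma Gamma_ratio_lower:
  fixes b y :: real
  assumes "0 < b" "1 < y"
  shows "(y - 1) powr b \<le> Gamma (y + b) / Gamma y"
proof -
  let ?f = "ln \<circ> Gamma :: real \<Rightarrow> real"
  note sl = convex_on_slope_le[OF log_convex_Gamma_real, of "y - 1" "y + b" y]
  have "(?f (y - 1) - ?f y) / (y - 1 - y) \<le> (?f y - ?f (y + b)) / (y - (y + b))"
    using sl assms by force
  then have "ln (Gamma y) - ln (Gamma (y - 1)) \<le> (ln (Gamma (y + b)) - ln (Gamma y)) / b"
    using assms by (simp add: field_simps)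
  moreover have "Gamma y = (y - 1) * Gamma (y - 1)"
    using Gamma_plus1[of "y - 1"] assms by (simp add: nonpos_Ints_def)
  moreover have "0 < Gamma (y - 1)" "0 < Gamma y" "0 < Gamma (y + b)" using assms by auto
  ultimately have "b * ln (y - 1) \<le> ln (Gamma (y + b)) - ln (Gamma y)"
    using assms by (simp add: ln_mult pos_le_divide_eq mult.commute less_imp_neq[symmetric])
  then have "b * ln (y - 1) \<le> ln (Gamma (y + b) / Gamma y)"
    using \<open>0 < Gamma y\<close> \<open>0 < Gamma (y + b)\<close> by (simp add: ln_div)
  then have "exp (b * ln (y - 1)) \<le> exp (ln (Gamma (y + b) / Gamma y))" by simp
  then show ?thesis using assms \<open>0 < Gamma y\<close> \<open>0 < Gamma (y + b)\<close> by (simp add: powr_def)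
qed

section \<open>Growth, positivity and integral representation of the eigenvalues\<close>

context
  fixes b :: real
  assumes b: "0 < b" "b < 1"
begin

text \<open>The Gamma quotient is the one of \<open>Gamma_ratio_lower\<close> at
  \<open>y = b N + 1 - b\<close>, so the growth is at least of order \<open>N^b\<close>.\<close>

lemma eigenvalue_tendsto: "filterlim (eigenvalue b) at_top sequentially"
proof (rule filterlim_at_top_mono)
  show "filterlim (\<lambda>N::nat. (b * real N - b) powr b - 1 / Gamma (1 - b)) at_top sequentially"
    using b by real_asymp
  show "\<forall>\<^sub>F N in sequentially. (b * real N - b) powr b - 1 / Gamma (1 - b) \<le> eigenvalue b N"
    using eventually_gt_at_top[of 1]
  proof eventually_elim
    case (elim N)
    then have "1 < b * real N + 1 - b" using b by (simp add: field_simps)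
    from Gamma_ratio_lower[OF b(1) this] show ?case
      by (simp add: eigenvalue_def algebra_simps)
  qed
qed

lemma eigenvalue_Beta:
  assumes "0 < N"
  shows "eigenvalue b N = (b * real N * Beta (b * real N) (1 - b) - 1) / Gamma (1 - b)"
proof -
  have "0 < b * real N" using b assms by simp
  then have "Gamma (1 + b * real N) = b * real N * Gamma (b * real N)"
    using Gamma_plus1[of "b * real N"] by (force simp: add.commute elim!: nonpos_Ints_cases)
  moreover have "0 < Gamma (1 - b)" using b by simp
  ultimately show ?thesis
    by (simp add: eigenvalue_def Beta_eq_Gamma_div field_simps)
qed

text \<open>The powers \<open>x^(b N)\<close> are eigenfunctions of \<open>L\<close>. The difference
  of Gamma terms that the series solution divides by thereby becomes an integral with nonnegative
  integrand, from which its bounds are derived.\<close>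

lemma levy_density_eigenvalue:
  shows "set_integrable lborel {0<..<1} (\<lambda>s. levy_density b s * (1 - (s powr b) ^ N))"
    and "(LBINT s:{0<..<1}. levy_density b s * (1 - (s powr b) ^ N)) = eigenvalue b N"
proof -
  have "set_integrable lborel {0<..<1} (\<lambda>s. levy_density b s * (1 - (s powr b) ^ N)) \<and>
    (LBINT s:{0<..<1}. levy_density b s * (1 - (s powr b) ^ N)) = eigenvalue b N"
  proof (cases "N = 0")
    case False
    then have p: "0 < b * real N" using b by simp
    have eq: "levy_density b s * (1 - (s powr b) ^ N) =
      1 / Gamma (1 - b) * (b * (1 - s) powr (- 1 - b) * (1 - s powr (b * real N)))" if "s \<in> {0<..<1}" for s
      using that by (simp add: levy_density_def powr_powr_nat)
    show ?thesis
      using set_lborel_levy[OF b p] False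
      by (subst set_integrable_cong[OF refl refl eq], simp, simp)
         (subst set_lebesgue_integral_cong[of _ _ _ "\<lambda>s. 1 / Gamma (1 - b) * (b * (1 - s) powr (- 1 - b) * (1 - s powr (b * real N)))"],
           auto simp: eq eigenvalue_Beta)
  qed (simp add: set_integrable_def)
  then show "set_integrable lborel {0<..<1} (\<lambda>s. levy_density b s * (1 - (s powr b) ^ N))"
    and "(LBINT s:{0<..<1}. levy_density b s * (1 - (s powr b) ^ N)) = eigenvalue b N" by auto
qed

lemma levy_nonneg: "0 \<le> levy_density b s"
  using b by (auto simp: levy_density_def intro!: mult_nonneg_nonneg)

text \<open>The density increases in \<open>s\<close>; the bound is its value at
  \<open>s = 0\<close>. It serves both positivity of the eigenvalues and the lower decay
  estimate.\<close>

lemma levy_ge: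
  assumes "s \<in> {0<..<1}"
  shows "b / Gamma (1 - b) \<le> levy_density b s"
proof -
  have "1 \<le> (1 - s) powr (- 1 - b)"
    using powr_mono2'[of "- 1 - b" "1 - s" 1] assms b by simp
  moreover have "0 < b / Gamma (1 - b)" using b by simp
  ultimately show ?thesis unfolding levy_density_def by (metis mult.right_neutral mult_left_mono less_imp_le)
qed

text \<open>Bernoulli's inequality under the integral. Linear growth is crude but enough, since
  multiplying coefficients by \<open>N\<close> keeps a series everywhere convergent.\<close>

lemma eigenvalue_le: "eigenvalue b N \<le> real N * eigenvalue b 1"
proof -
  have "(LBINT s:{0<..<1}. levy_density b s * (1 - (s powr b) ^ N)) \<le>
        (LBINT s:{0<..<1}. real N * (levy_density b s * (1 - (s powr b) ^ 1)))"
  proof (rule set_integral_mono)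
    fix s :: real assume s: "s \<in> {0<..<1}"
    have "1 - (s powr b) ^ N \<le> real N * (1 - s powr b)"
      using Bernoulli_inequality[of "s powr b - 1" N] by (simp add: algebra_simps)
    from mult_left_mono[OF this levy_nonneg[of s]]
    show "levy_density b s * (1 - (s powr b) ^ N) \<le> real N * (levy_density b s * (1 - (s powr b) ^ 1))"
      by (simp add: mult_ac)
  qed (intro set_integrable_mult_right levy_density_eigenvalue)+
  then show ?thesis using levy_density_eigenvalue(2)[of N] levy_density_eigenvalue(2)[of 1] by simp
qed

text \<open>With the density replaced by its lower bound the integral is explicit and positive. This
  justifies the divisions in \<open>sol_coeff\<close>.\<close>

lemma eigenvalue_pos:
  assumes "0 < N"
  shows "0 < eigenvalue b N"
proof -
  have p: "0 < b * real N" using b assms by simp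
  let ?c = "b / Gamma (1 - b)"
  have hi: "((\<lambda>s::real. ?c * (1 - s powr (b * real N))) has_integral ?c * (1 - 1 / (b * real N + 1))) {0..1}"
    using has_integral_powr_from_0[of "b * real N" 1] p has_integral_const_real[of "1::real" 0 1]
    by (intro has_integral_mult_right has_integral_diff) auto
  have G: "0 < ?c" using b by simp
  have ci: "continuous_on {0<..<1} (\<lambda>s::real. ?c * (1 - s powr (b * real N)))"
    by (intro continuous_intros) auto
  have nn: "0 \<le> ?c * (1 - s powr (b * real N))" if "s \<in> {0<..<1}" for s
    using that p G by (intro mult_nonneg_nonneg) (auto simp: powr_le1)
  note I = set_lborel_of_has_integral_nonneg[OF hi ci nn]
  have "0 < ?c * (1 - 1 / (b * real N + 1))"
    using G p by (intro mult_pos_pos) auto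
  also have "\<dots> = (LBINT s:{0<..<1}. ?c * (1 - s powr (b * real N)))" by (rule I(2)[symmetric])
  also have "\<dots> \<le> (LBINT s:{0<..<1}. levy_density b s * (1 - (s powr b) ^ N))"
  proof (rule set_integral_mono[OF I(1) levy_density_eigenvalue(1)])
    fix s :: real assume s: "s \<in> {0<..<1}"
    then show "?c * (1 - s powr (b * real N)) \<le> levy_density b s * (1 - (s powr b) ^ N)"
      using mult_right_mono[OF levy_ge[OF s], of "1 - s powr (b * real N)"] p s
      by (simp add: powr_powr_nat powr_le1)
  qed
  finally show ?thesis using levy_density_eigenvalue(2) by simp
qed

lemma sol_coeff_Suc: "eigenvalue b (Suc N) * sol_coeff b l (Suc N) = l * sol_coeff b l N"
  using eigenvalue_pos[of "Suc N"] by (simp add: sol_coeff_def)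

lemma entire_sol_coeff: "entire (sol_coeff b l)"
  unfolding entire_def
proof
  fix z :: real
  have "\<forall>\<^sub>F N in sequentially. 2 * \<bar>l\<bar> * \<bar>z\<bar> \<le> eigenvalue b N"
    using eigenvalue_tendsto by (auto simp: filterlim_at_top)
  \<comment> \<open>The factor 2 in the threshold yields the ratio 1/2 in the ratio test.\<close>
  then obtain M where M: "\<And>N. M \<le> N \<Longrightarrow> 2 * \<bar>l\<bar> * \<bar>z\<bar> \<le> eigenvalue b N"
    by (auto simp: eventually_sequentially)
  show "summable (\<lambda>N. sol_coeff b l N * z ^ N)"
  proof (rule summable_ratio_test[of "1/2"])
    fix n assume "M \<le> n"
    let ?a = "sol_coeff b l"
    have e: "0 < eigenvalue b (Suc n)" by (rule eigenvalue_pos) simp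
    have "eigenvalue b (Suc n) * \<bar>?a (Suc n)\<bar> = \<bar>l\<bar> * \<bar>?a n\<bar>"
      using sol_coeff_Suc[of n l] e by (metis abs_mult abs_of_pos)
    then have "eigenvalue b (Suc n) * norm (?a (Suc n) * z ^ Suc n) = (\<bar>l\<bar> * \<bar>z\<bar>) * norm (?a n * z ^ n)"
      by (simp add: abs_mult mult_ac)
    also have "\<dots> \<le> (1 / 2 * eigenvalue b (Suc n)) * norm (?a n * z ^ n)"
      using M[of "Suc n"] \<open>M \<le> n\<close> by (intro mult_right_mono) auto
    finally have "eigenvalue b (Suc n) * norm (?a (Suc n) * z ^ Suc n) \<le> eigenvalue b (Suc n) * (1 / 2 * norm (?a n * z ^ n))"
      by linarith
    then show "norm (?a (Suc n) * z ^ Suc n) \<le> 1 / 2 * norm (?a n * z ^ n)"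
      using e by (simp only: mult_le_cancel_left_pos)
  qed simp
qed

end

subsection \<open>Averages of power series over dilations\<close>

lemma set_integral_cong_on:
  "(\<And>x. x \<in> A \<Longrightarrow> f x = g x) \<Longrightarrow> (LINT x:A|M. f x) = (LINT x:A|M. g x)"
  unfolding set_lebesgue_integral_def by (intro Bochner_Integration.integral_cong) (auto simp: indicator_def)

definition powser :: "real \<Rightarrow> (nat \<Rightarrow> real) \<Rightarrow> real \<Rightarrow> real" where
  "powser b a x = (\<Sum>N. a N * (x powr b) ^ N)"

lemma powser_sums: "entire a \<Longrightarrow> (\<lambda>N. a N * (x powr b) ^ N) sums powser b a x"
  by (simp add: powser_def entire_def summable_sums)

lemma powser_0: "powser b a 0 = a 0"
  unfolding powser_def by (simp add: powser_zero)

lemma powser_scale: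
  assumes "0 \<le> x" "0 \<le> s"
  shows "powser b a (x * s) = (\<Sum>N. (a N * (x powr b) ^ N) * (s powr b) ^ N)"
  using assms by (simp add: powser_def powr_mult power_mult_distrib mult.assoc)

lemma continuous_on_powser:
  assumes "entire a" "0 < b"
  shows "continuous_on {0..} (powser b a)"
proof -
  have "continuous_on UNIV (\<lambda>z. \<Sum>N. a N * z ^ N)"
    using assms(1) isCont_powser_converges_everywhere
    by (auto simp: continuous_on_eq_continuous_at entire_def)
  moreover have "continuous_on {0..} (\<lambda>x::real. x powr b)"
    using assms by (intro continuous_on_powr') auto
  ultimately show ?thesis
    unfolding powser_def by (rule continuous_on_compose2) auto
qed

text \<open>Averaging over dilations acts diagonally on power series in \<open>x^b\<close>: the
  coefficient of index \<open>N\<close> is multiplied by a moment of \<open>k\<close>. As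
  \<open>s^(b N) <= 1\<close>, all moments are bounded by the one of index 0, which gives the
  domination.\<close>

lemma powser_average:
  assumes a: "entire a" and x: "0 \<le> x" and b: "0 < b"
    and k: "\<And>s. s \<in> {0<..<1} \<Longrightarrow> 0 \<le> k s"
    and int: "\<And>N. set_integrable lborel {0<..<1} (\<lambda>s. k s * (s powr b) ^ N)"
  shows "set_integrable lborel {0<..<1} (\<lambda>s. k s * powser b a (x * s))"
    and "(\<lambda>N. a N * (LBINT s:{0<..<1}. k s * (s powr b) ^ N) * (x powr b) ^ N) sums
      (LBINT s:{0<..<1}. k s * powser b a (x * s))"
proof -
  let ?m = "\<lambda>N. LBINT s:{0<..<1}. k s * (s powr b) ^ N"
  let ?a = "\<lambda>N. a N * (x powr b) ^ N"
  have le: "(s powr b) ^ N \<le> 1" if "s \<in> {0<..<1}" for s N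
    using that b by (intro power_le_one) (auto simp: powr_le1)
  have m0: "0 \<le> ?m N" for N
    using k unfolding set_lebesgue_integral_def by (intro integral_nonneg_AE) (auto simp: indicator_def)
  have m1: "?m N \<le> ?m 0" for N
    using k le by (intro set_integral_mono int) (auto intro: mult_left_le)
  have abs: "summable (\<lambda>N. \<bar>?a N\<bar>)"
    using entire_abs[OF a, of "x powr b"] by (simp add: abs_mult)
  have s1: "summable (\<lambda>N. \<bar>?a N\<bar> * ?m N)"
  proof (rule summable_comparison_test')
    show "summable (\<lambda>N. \<bar>?a N\<bar> * ?m 0)" by (intro summable_mult2 abs)
    show "norm (\<bar>?a N\<bar> * ?m N) \<le> \<bar>?a N\<bar> * ?m 0" for N
      using m0[of N] m1[of N] by (auto simp: abs_mult intro!: mult_left_mono)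
  qed
  have s2: "summable (\<lambda>N. \<bar>?a N\<bar> * (k s * (s powr b) ^ N))" if s: "s \<in> {0<..<1}" for s
  proof (rule summable_comparison_test')
    show "summable (\<lambda>N. \<bar>?a N\<bar> * k s)" by (intro summable_mult2 abs)
    show "norm (\<bar>?a N\<bar> * (k s * (s powr b) ^ N)) \<le> \<bar>?a N\<bar> * k s" for N
      using k[OF s] le[OF s, of N] by (auto simp: abs_mult intro!: mult_left_mono mult_left_le)
  qed
  have eq: "(\<Sum>N. ?a N * (k s * (s powr b) ^ N)) = k s * powser b a (x * s)" if "s \<in> {0<..<1}" for s
  proof -
    have "summable (\<lambda>N. ?a N * (s powr b) ^ N)"
      using a x that by (simp add: entire_def power_mult_distrib[symmetric] mult.assoc)
    from suminf_mult[OF this, of "k s"] show ?thesis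
      using x that by (simp add: powser_scale mult_ac)
  qed
  note T = set_lborel_termwise[of "{0<..<1}" "\<lambda>N s. k s * (s powr b) ^ N" ?a, OF int _ s1 s2]
  have nn: "\<And>N s. s \<in> {0<..<1} \<Longrightarrow> 0 \<le> k s * (s powr b) ^ N" using k by auto
  show "set_integrable lborel {0<..<1} (\<lambda>s. k s * powser b a (x * s))"
    using T(1)[OF nn] by (subst set_integrable_cong[OF refl refl eq[symmetric]])
  have "(LBINT s:{0<..<1}. k s * powser b a (x * s)) = (\<Sum>N. ?a N * ?m N)"
    using T(2)[OF nn] by (subst set_integral_cong_on[OF eq[symmetric]])
  moreover have "summable (\<lambda>N. ?a N * ?m N)"
    by (rule summable_rabs_cancel) (use s1 m0 in \<open>simp add: abs_mult\<close>)
  ultimately show "(\<lambda>N. a N * ?m N * (x powr b) ^ N) sums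
      (LBINT s:{0<..<1}. k s * powser b a (x * s))"
    by (simp add: summable_sums mult_ac)
qed

lemma sol_series_powser: "sol_series b l = powser b (sol_coeff b l)"
  by (simp add: sol_series_def powser_def fun_eq_iff)

text \<open>Arises by applying the Riemann-Liouville integral of order \<open>b\<close> to
  \<open>(r^(-b) / Gamma (1 - b) + l) u(r)\<close> and substituting \<open>r = x s\<close>; the
  scaling factor \<open>x^b\<close> cancels against \<open>x^(-b)\<close> in the first summand and
  survives in the second.\<close>

definition renewal_kernel :: "real \<Rightarrow> real \<Rightarrow> real \<Rightarrow> real \<Rightarrow> real" where
  "renewal_kernel b l x s = (1 - s) powr (b - 1) / Gamma b * (s powr (- b) / Gamma (1 - b) + l * x powr b)"

section \<open>The operator \<open>L\<close> and the renewal kernel acting on power series\<close>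

context
  fixes b :: real
  assumes b: "0 < b" "b < 1"
begin

text \<open>The factor \<open>1 - s^(b N)\<close> tames the singularity at \<open>s = 1\<close> term
  by term; the integrals of the terms are controlled by \<open>N |a N|\<close> through
  \<open>eigenvalue_le\<close>.\<close>

lemma powser_levy:
  assumes a: "entire a" and x: "0 \<le> x"
  shows "set_integrable lborel {0<..<1} (\<lambda>s. levy_density b s * (powser b a x - powser b a (x * s)))"
    and "(\<lambda>N. eigenvalue b N * a N * (x powr b) ^ N) sums
      (LBINT s:{0<..<1}. levy_density b s * (powser b a x - powser b a (x * s)))"
proof -
  let ?a = "\<lambda>N. a N * (x powr b) ^ N"
  let ?h = "\<lambda>N s. levy_density b s * (1 - (s powr b) ^ N)"
  have le: "(s powr b) ^ N \<le> 1" if "s \<in> {0<..<1}" for s N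
    using that b by (intro power_le_one) (auto simp: powr_le1)
  have e0: "0 \<le> eigenvalue b N" for N
    using eigenvalue_pos[OF b, of N] eigenvalue_0 by (cases "N = 0") auto
  have abs: "summable (\<lambda>N. \<bar>?a N\<bar>)"
    using entire_abs[OF a, of "x powr b"] by (simp add: abs_mult)
  have absN: "summable (\<lambda>N. real N * \<bar>?a N\<bar>)"
    using entire_abs[OF entire_mult_of_nat[OF a], of "x powr b"] by (simp add: abs_mult mult_ac)
  have s1: "summable (\<lambda>N. \<bar>?a N\<bar> * eigenvalue b N)"
  proof (rule summable_comparison_test')
    show "summable (\<lambda>N. real N * \<bar>?a N\<bar> * eigenvalue b 1)" by (intro summable_mult2 absN)
    show "norm (\<bar>?a N\<bar> * eigenvalue b N) \<le> real N * \<bar>?a N\<bar> * eigenvalue b 1" for N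
      using mult_left_mono[OF eigenvalue_le[OF b, of N], of "\<bar>?a N\<bar>"] e0[of N] by (simp add: abs_mult mult_ac)
  qed
  have s2: "summable (\<lambda>N. \<bar>?a N\<bar> * ?h N s)" if s: "s \<in> {0<..<1}" for s
  proof (rule summable_comparison_test')
    show "summable (\<lambda>N. \<bar>?a N\<bar> * levy_density b s)" by (intro summable_mult2 abs)
    show "norm (\<bar>?a N\<bar> * ?h N s) \<le> \<bar>?a N\<bar> * levy_density b s" for N
      using levy_nonneg[OF b, of s] le[OF s, of N] by (auto simp: abs_mult intro!: mult_left_mono mult_left_le)
  qed
  have eq: "(\<Sum>N. ?a N * ?h N s) = levy_density b s * (powser b a x - powser b a (x * s))" if "s \<in> {0<..<1}" for s
  proof -
    have 1: "summable (\<lambda>N. ?a N * (s powr b) ^ N)"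
      using a x that by (simp add: entire_def power_mult_distrib[symmetric] mult.assoc)
    have 2: "summable ?a" using a by (simp add: entire_def)
    have "(\<Sum>N. ?a N * ?h N s) = (\<Sum>N. levy_density b s * (?a N - ?a N * (s powr b) ^ N))"
      by (simp add: algebra_simps)
    also have "\<dots> = levy_density b s * ((\<Sum>N. ?a N) - (\<Sum>N. ?a N * (s powr b) ^ N))"
      using 1 2 by (simp only: suminf_mult[OF summable_diff[OF 2 1]] suminf_diff[OF 2 1])
    finally show ?thesis
      using x that powser_scale[of x s b a] by (simp add: powser_def[of b a x])
  qed
  have nn: "\<And>N s. s \<in> {0<..<1} \<Longrightarrow> 0 \<le> ?h N s"
    using levy_nonneg[OF b] le by auto
  note T = set_lborel_termwise[of "{0<..<1}" ?h ?a, OF levy_density_eigenvalue(1)[OF b] nn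
      s1[folded levy_density_eigenvalue(2)[OF b]] s2, unfolded levy_density_eigenvalue(2)[OF b]]
  show "set_integrable lborel {0<..<1} (\<lambda>s. levy_density b s * (powser b a x - powser b a (x * s)))"
    using T(1) by (subst set_integrable_cong[OF refl refl eq[symmetric]])
  have "(LBINT s:{0<..<1}. levy_density b s * (powser b a x - powser b a (x * s))) = (\<Sum>N. ?a N * eigenvalue b N)"
    using T(2) by (subst set_integral_cong_on[OF eq[symmetric]])
  moreover have "summable (\<lambda>N. ?a N * eigenvalue b N)"
    by (rule summable_rabs_cancel) (use s1 e0 in \<open>simp add: abs_mult\<close>)
  ultimately show "(\<lambda>N. eigenvalue b N * a N * (x powr b) ^ N) sums
      (LBINT s:{0<..<1}. levy_density b s * (powser b a x - powser b a (x * s)))"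
    by (simp add: summable_sums mult_ac)
qed

lemma kernel_moments:
  assumes q: "0 < q"
  shows "set_integrable lborel {0<..<1} (\<lambda>s. (s powr (q - 1) * (1 - s) powr (b - 1)) * (s powr b) ^ N)"
    and "(LBINT s:{0<..<1}. (s powr (q - 1) * (1 - s) powr (b - 1)) * (s powr b) ^ N) = Beta (b * real N + q) b"
proof -
  have p: "0 < b * real N + q" using b q by (intro add_nonneg_pos) auto
  have eq: "(s powr (q - 1) * (1 - s) powr (b - 1)) * (s powr b) ^ N =
    s powr (b * real N + q - 1) * (1 - s) powr (b - 1)" if "s \<in> {0<..<1}" for s
    using that by (simp add: powr_powr_nat powr_add[symmetric] algebra_simps)
  show "set_integrable lborel {0<..<1} (\<lambda>s. (s powr (q - 1) * (1 - s) powr (b - 1)) * (s powr b) ^ N)"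
    using set_lborel_Beta(1)[OF p b(1)] by (subst set_integrable_cong[OF refl refl eq])
  show "(LBINT s:{0<..<1}. (s powr (q - 1) * (1 - s) powr (b - 1)) * (s powr b) ^ N) = Beta (b * real N + q) b"
    using set_lborel_Beta(2)[OF p b(1)] by (subst set_integral_cong_on[OF eq])
qed

text \<open>Comparison of coefficients: the \<open>s^(-b)\<close> part of the kernel reproduces the
  fraction \<open>?m1 N\<close> of coefficient \<open>N\<close>, and the \<open>l x^b\<close> part,
  which raises the index by one, supplies the remaining fraction \<open>1 - ?m1 N\<close>.\<close>

lemma sol_series_renewal:
  assumes x: "0 \<le> x"
  shows "set_integrable lborel {0<..<1} (\<lambda>s. renewal_kernel b l x s * sol_series b l (x * s))"
    and "sol_series b l x = (LBINT s:{0<..<1}. renewal_kernel b l x s * sol_series b l (x * s))"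
proof -
  let ?a = "sol_coeff b l" and ?z = "x powr b" and ?F = "sol_series b l"
  let ?k1 = "\<lambda>s::real. s powr ((1 - b) - 1) * (1 - s) powr (b - 1)"
  \<comment> \<open>The trivial exponent is kept so that the moments of \<open>?k2\<close> are the
    instance \<open>q = 1\<close> of \<open>kernel_moments\<close>.\<close>
  let ?k2 = "\<lambda>s::real. s powr (1 - 1) * (1 - s) powr (b - 1)"
  have q: "0 < 1 - b" using b by simp
  have G: "0 < Gamma b" "0 < Gamma (1 - b)" using b by auto
  note P1 = powser_average[OF entire_sol_coeff[OF b] x b(1), of ?k1, unfolded kernel_moments[OF q], OF _ kernel_moments(1)[OF q]]
  note P2 = powser_average[OF entire_sol_coeff[OF b] x b(1), of ?k2, unfolded kernel_moments[OF zero_less_one], OF _ kernel_moments(1)[OF zero_less_one]]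
  have I1: "set_integrable lborel {0<..<1} (\<lambda>s. ?k1 s * ?F (x * s))"
    and I2: "set_integrable lborel {0<..<1} (\<lambda>s. ?k2 s * ?F (x * s))"
    unfolding sol_series_powser using P1(1) P2(1) by auto
  let ?S1 = "LBINT s:{0<..<1}. ?k1 s * ?F (x * s)" and ?S2 = "LBINT s:{0<..<1}. ?k2 s * ?F (x * s)"
  let ?c1 = "1 / (Gamma b * Gamma (1 - b))" and ?c2 = "l * ?z / Gamma b"
  have eq: "renewal_kernel b l x s * ?F (x * s) = ?c1 * (?k1 s * ?F (x * s)) + ?c2 * (?k2 s * ?F (x * s))"
    if "s \<in> {0<..<1}" for s
    using that G by (simp add: renewal_kernel_def algebra_simps add_divide_distrib)
  show "set_integrable lborel {0<..<1} (\<lambda>s. renewal_kernel b l x s * ?F (x * s))"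
    by (subst set_integrable_cong[OF refl refl eq]) (intro set_integral_add set_integrable_mult_right I1 I2 | simp)+
  have int: "(LBINT s:{0<..<1}. renewal_kernel b l x s * ?F (x * s)) = ?c1 * ?S1 + ?c2 * ?S2"
  proof -
    have "(LBINT s:{0<..<1}. renewal_kernel b l x s * ?F (x * s)) =
      (LBINT s:{0<..<1}. ?c1 * (?k1 s * ?F (x * s)) + ?c2 * (?k2 s * ?F (x * s)))"
      by (rule set_integral_cong_on[OF eq])
    also have "\<dots> = (LBINT s:{0<..<1}. ?c1 * (?k1 s * ?F (x * s))) + (LBINT s:{0<..<1}. ?c2 * (?k2 s * ?F (x * s)))"
      by (intro set_integral_add set_integrable_mult_right I1 I2)
    finally show ?thesis by (simp only: set_integral_mult_right)
  qed
  let ?m1 = "\<lambda>N. ?c1 * Beta (b * real N + (1 - b)) b"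
  have s1: "(\<lambda>N. ?c1 * (?a N * Beta (b * real N + (1 - b)) b * ?z ^ N)) sums (?c1 * ?S1)"
    unfolding sol_series_powser using P1(2) by (intro sums_mult) auto
  have s2: "(\<lambda>N. ?c2 * (?a N * Beta (b * real N + 1) b * ?z ^ N)) sums (?c2 * ?S2)"
    unfolding sol_series_powser using P2(2) by (intro sums_mult) auto
  \<comment> \<open>Here the eigenvalue enters: \<open>1 - ?m1 (Suc N)\<close> is
    \<open>eigenvalue b (Suc N)\<close> times a Gamma quotient, so \<open>sol_coeff_Suc\<close>
    lowers the index.\<close>
  have rec: "?c2 * (?a N * Beta (b * real N + 1) b * ?z ^ N) = ?a (Suc N) * (1 - ?m1 (Suc N)) * ?z ^ Suc N" for N
  proof -
    have pos: "0 < Gamma (1 + b * real N)" "0 < Gamma (1 + b * real N + b)"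
      using b by (auto intro!: Gamma_real_pos add_pos_nonneg)
    have e: "eigenvalue b (Suc N) = Gamma (1 + b * real N + b) / Gamma (1 + b * real N) - 1 / Gamma (1 - b)"
      by (simp add: eigenvalue_def algebra_simps)
    have m: "?m1 (Suc N) = Gamma (1 + b * real N) / (Gamma (1 + b * real N + b) * Gamma (1 - b))"
      using G by (simp add: Beta_eq_Gamma_div algebra_simps)
    have "1 - ?m1 (Suc N) = eigenvalue b (Suc N) * (Gamma (1 + b * real N) / Gamma (1 + b * real N + b))"
      unfolding e m using G pos by (simp add: field_simps)
    then have "?a (Suc N) * (1 - ?m1 (Suc N)) = l * ?a N * (Gamma (1 + b * real N) / Gamma (1 + b * real N + b))"
      using sol_coeff_Suc[OF b, of N l] by (metis mult.assoc mult.commute)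
    then show ?thesis using G by (simp add: Beta_eq_Gamma_div add_ac)
  qed
  have "(\<lambda>N. ?a N * (1 - ?m1 N) * ?z ^ N) sums (?c2 * ?S2 + ?a 0 * (1 - ?m1 0) * ?z ^ 0)"
    using s2 unfolding rec by (rule sums_Suc)
  \<comment> \<open>Criticality of the kernel: the constant term is reproduced by the first part
    alone, so the shifted series may start at 0.\<close>
  moreover have "?m1 0 = 1" using G by (simp add: Beta_eq_Gamma_div)
  then have "?a 0 * (1 - ?m1 0) * ?z ^ 0 = 0" by (simp only: diff_self mult_zero_left mult_zero_right)
  ultimately have "(\<lambda>N. ?a N * (1 - ?m1 N) * ?z ^ N) sums (?c2 * ?S2)"
    by (simp only: add_0_right)
  from sums_add[OF s1 this] have "(\<lambda>N. ?a N * ?z ^ N) sums (?c1 * ?S1 + ?c2 * ?S2)"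
    by (rule back_subst[of "\<lambda>f. f sums _"]) (auto simp: algebra_simps)
  then show "?F x = (LBINT s:{0<..<1}. renewal_kernel b l x s * ?F (x * s))"
    unfolding int by (simp add: sol_series_def sums_iff)
qed

end

subsection \<open>Abel inversion\<close>

lemma RL_integral_scale:
  assumes "0 < x"
  shows "RL_integral a u x = x powr a * (LBINT s:{0<..<1}. (1 - s) powr (a - 1) / Gamma a * u (x * s))"
proof -
  have "RL_integral a u x = x * (LBINT s:{0<..<1}. (x - x * s) powr (a - 1) / Gamma a * u (x * s))"
    using set_lborel_scale(1)[OF assms, of 0] by (simp add: RL_integral_def)
  also have "(LBINT s:{0<..<1}. (x - x * s) powr (a - 1) / Gamma a * u (x * s)) =
      (LBINT s:{0<..<1}. x powr (a - 1) * ((1 - s) powr (a - 1) / Gamma a * u (x * s)))"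
  proof (rule set_integral_cong_on)
    fix s :: real assume "s \<in> {0<..<1}"
    then have "(x * (1 - s)) powr (a - 1) = x powr (a - 1) * (1 - s) powr (a - 1)"
      by (simp add: powr_mult)
    then show "(x - x * s) powr (a - 1) / Gamma a * u (x * s) =
      x powr (a - 1) * ((1 - s) powr (a - 1) / Gamma a * u (x * s))"
      by (simp add: right_diff_distrib)
  qed
  also have "\<dots> = x powr (a - 1) * (LBINT s:{0<..<1}. (1 - s) powr (a - 1) / Gamma a * u (x * s))"
    by (rule set_integral_mult_right)
  finally show ?thesis
    using powr_mult_base[of x "a - 1"] assms by (simp only: mult.assoc[symmetric]) simp
qed

text \<open>The exponents add up to -1, so the length of the interval cancels and Beta(1-a, a)
  remains, with denominator \<open>Gamma 1 = 1\<close>.\<close>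

lemma Abel_kernel:
  fixes a s x :: real
  assumes a: "0 < a" "a < 1" and "s < x"
  shows "set_integrable lborel {s<..<x} (\<lambda>r. (x - r) powr (a - 1) * (r - s) powr (- a))"
    and "(LBINT r:{s<..<x}. (x - r) powr (a - 1) * (r - s) powr (- a)) = Gamma a * Gamma (1 - a)"
proof -
  let ?c = "x - s"
  have c: "0 < ?c" "{s<..<x} = {s<..<s + ?c}" using assms by auto
  have eq: "(x - (s + ?c * t)) powr (a - 1) * (s + ?c * t - s) powr (- a) =
      1 / ?c * (t powr ((1 - a) - 1) * (1 - t) powr (a - 1))" if "t \<in> {0<..<1}" for t
  proof -
    have "x - (s + ?c * t) = ?c * (1 - t)" by (simp add: algebra_simps)
    then have "(x - (s + ?c * t)) powr (a - 1) * (s + ?c * t - s) powr (- a) =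
      (?c powr (a - 1) * ?c powr (- a)) * (t powr (- a) * (1 - t) powr (a - 1))"
      using that c by (simp add: powr_mult)
    also have "?c powr (a - 1) * ?c powr (- a) = 1 / ?c"
      using c by (simp add: powr_diff powr_minus)
    finally show ?thesis by simp
  qed
  have p: "0 < 1 - a" using a by simp
  note B = set_lborel_Beta[OF p a(1)]
  show "set_integrable lborel {s<..<x} (\<lambda>r. (x - r) powr (a - 1) * (r - s) powr (- a))"
    unfolding c(2) set_lborel_scale(2)[OF c(1)]
    by (subst set_integrable_cong[OF refl refl eq], assumption) (intro set_integrable_mult_right B)
  show "(LBINT r:{s<..<x}. (x - r) powr (a - 1) * (r - s) powr (- a)) = Gamma a * Gamma (1 - a)"
    unfolding c(2) set_lborel_scale(1)[OF c(1)]
    by (subst set_integral_cong_on[OF eq], assumption) (use B(2) c(1) in \<open>simp add: Beta_eq_Gamma_div\<close>)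
qed

text \<open>Fubini over the triangle \<open>0 < s < r < x\<close>; the inner integral in
  \<open>r\<close> is the constant of \<open>Abel_kernel\<close>.\<close>

lemma RL_integral_RL_integral:
  fixes a x :: real
  assumes a: "0 < a" "a < 1" and h: "set_integrable lborel {0<..<x} h"
  shows "RL_integral a (RL_integral (1 - a) h) x = (LBINT s:{0<..<x}. h s)"
proof -
  define H where "H s = indicator {0<..<x} s * h s" for s
  \<comment> \<open>Extension by zero encodes the triangle. For \<open>s >= x\<close> the section is
    zero instead of having the Abel integral, but there \<open>H s = 0\<close>.\<close>
  define k where "k s r = (if s < r \<and> r < x then (x - r) powr (a - 1) * (r - s) powr (- a) else 0)" for s r
  have H: "integrable lborel H" using h by (simp add: H_def[abs_def] set_integrable_def)
  have [measurable]: "H \<in> borel_measurable borel"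
    using borel_measurable_integrable[OF H] by simp
  have [measurable]: "case_prod k \<in> borel_measurable (borel \<Otimes>\<^sub>M borel)"
    unfolding k_def[abs_def] by measurable
  have G: "0 < Gamma a" "0 < Gamma (1 - a)" using a by auto
  have k0: "0 \<le> k s r" for s r by (simp add: k_def)
  have ki: "k s = (\<lambda>r. indicator {s<..<x} r *\<^sub>R ((x - r) powr (a - 1) * (r - s) powr (- a)))" for s
    by (auto simp: k_def indicator_def)
  have kint: "integrable lborel (k s)" "(\<integral>r. k s r \<partial>lborel) = Gamma a * Gamma (1 - a)" if "s < x" for s
    using Abel_kernel[OF a that] by (auto simp: ki set_integrable_def set_lebesgue_integral_def)
  have Hk: "(\<integral>r. k s r * H s \<partial>lborel) = Gamma a * Gamma (1 - a) * H s" for s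
    using kint(2)[of s] by (cases "s < x") (auto simp: H_def)
  have Hkn: "(\<integral>r. norm (k s r * H s) \<partial>lborel) = Gamma a * Gamma (1 - a) * norm (H s)" for s
    using kint(2)[of s] k0 by (cases "s < x") (auto simp: H_def abs_mult)
  have int: "integrable (lborel \<Otimes>\<^sub>M lborel) (\<lambda>(s, r). k s r * H s)"
  proof (rule lborel_pair.Fubini_integrable)
    show "(\<lambda>(s, r). k s r * H s) \<in> borel_measurable (lborel \<Otimes>\<^sub>M lborel)"
      by measurable
    show "integrable lborel (\<lambda>s. \<integral>r. norm (case (s, r) of (s, r) \<Rightarrow> k s r * H s) \<partial>lborel)"
      using H by (simp add: Hkn del: real_norm_def)
    have "integrable lborel (\<lambda>r. k s r * H s)" for s
      using kint(1)[of s] by (cases "s < x") (auto simp: H_def)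
    then show "AE s in lborel. integrable lborel (\<lambda>r. case (s, r) of (s, r) \<Rightarrow> k s r * H s)"
      by simp
  qed
  have inner: "(\<integral>s. k s r * H s \<partial>lborel) =
      indicator {0<..<x} r * ((x - r) powr (a - 1) * Gamma (1 - a) * RL_integral (1 - a) h r)" for r
  proof (cases "r \<in> {0<..<x}")
    case True
    have "(\<integral>s. k s r * H s \<partial>lborel) =
      (\<integral>s. (x - r) powr (a - 1) * Gamma (1 - a) *
         (indicator {0<..<r} s *\<^sub>R ((r - s) powr (1 - a - 1) / Gamma (1 - a) * h s)) \<partial>lborel)"
      using True G by (intro Bochner_Integration.integral_cong) (auto simp: k_def H_def indicator_def)
    then show ?thesis
      using True by (simp add: RL_integral_def set_lebesgue_integral_def)
  next
    case False
    then have "(\<lambda>s. k s r * H s) = (\<lambda>_. 0)"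
      by (auto simp: fun_eq_iff k_def H_def indicator_def)
    with False show ?thesis by simp
  qed
  have "RL_integral a (RL_integral (1 - a) h) x =
    (\<integral>r. (\<integral>s. k s r * H s \<partial>lborel) / (Gamma a * Gamma (1 - a)) \<partial>lborel)"
    unfolding inner RL_integral_def[of a] set_lebesgue_integral_def
    using G by (intro Bochner_Integration.integral_cong) (auto simp: indicator_def)
  also have "\<dots> = (\<integral>r. (\<integral>s. k s r * H s \<partial>lborel) \<partial>lborel) / (Gamma a * Gamma (1 - a))"
    by simp
  also have "(\<integral>r. (\<integral>s. k s r * H s \<partial>lborel) \<partial>lborel) = (\<integral>s. (\<integral>r. k s r * H s \<partial>lborel) \<partial>lborel)"
    using lborel_pair.Fubini_integral[OF int] by simp
  also have "\<dots> = Gamma a * Gamma (1 - a) * (\<integral>s. H s \<partial>lborel)" by (simp only: Hk integral_mult_right_zero)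
  finally show ?thesis
    using G by (simp add: H_def set_lebesgue_integral_def)
qed

lemma set_integrable_mult_bounded:
  fixes k w :: "real \<Rightarrow> real"
  assumes k: "set_integrable lborel A k" and w: "continuous_on A w" and A: "A \<in> sets borel"
    and bd: "\<And>s. s \<in> A \<Longrightarrow> \<bar>w s\<bar> \<le> B"
  shows "set_integrable lborel A (\<lambda>s. k s * w s)"
proof (rule set_integrable_bound[of _ _ "\<lambda>s. B * k s"])
  show "set_integrable lborel A (\<lambda>s. B * k s)" using k by simp
  have "(\<lambda>s. indicator A s *\<^sub>R k s) \<in> borel_measurable borel"
    using borel_measurable_integrable[OF k[unfolded set_integrable_def]] by simp
  moreover have "(\<lambda>s. indicator A s *\<^sub>R w s) \<in> borel_measurable borel"
    using w A by (rule borel_measurable_continuous_on_indicator[rotated])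
  ultimately have "(\<lambda>s. (indicator A s *\<^sub>R k s) * (indicator A s *\<^sub>R w s)) \<in> borel_measurable borel"
    by (rule borel_measurable_times)
  also have "(\<lambda>s. (indicator A s *\<^sub>R k s) * (indicator A s *\<^sub>R w s)) = (\<lambda>s. indicator A s *\<^sub>R (k s * w s))"
    by (auto simp: indicator_def)
  finally show "set_borel_measurable lborel A (\<lambda>s. k s * w s)"
    by (simp add: set_borel_measurable_def)
  show "AE x in lborel. x \<in> A \<longrightarrow> norm (k x * w x) \<le> norm (B * k x)"
  proof (intro AE_I2 impI)
    fix x assume "x \<in> A"
    from mult_left_mono[OF bd[OF this], of "\<bar>k x\<bar>"] bd[OF this]
    show "norm (k x * w x) \<le> norm (B * k x)"
      by (simp add: abs_mult mult.commute)
  qed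
qed

subsection \<open>Uniqueness for the renewal equation\<close>

lemma set_integral_pos:
  fixes f :: "real \<Rightarrow> real"
  assumes f: "set_integrable lborel {a<..<b} f" and pos: "\<And>s. s \<in> {a<..<b} \<Longrightarrow> 0 < f s" and "a < b"
  shows "0 < (LBINT s:{a<..<b}. f s)"
proof -
  let ?g = "\<lambda>s. indicator {a<..<b} s *\<^sub>R f s"
  have nn: "AE s in lborel. 0 \<le> ?g s" using pos by (intro AE_I2) (auto simp: indicator_def less_imp_le)
  have "(LBINT s:{a<..<b}. f s) \<noteq> 0"
  proof
    assume "(LBINT s:{a<..<b}. f s) = 0"
    then have "AE s in lborel. ?g s = 0"
      using integral_nonneg_eq_0_iff_AE[OF f[unfolded set_integrable_def] nn]
      by (simp add: set_lebesgue_integral_def)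
    then have "AE s in lborel. s \<notin> {a<..<b}"
      by eventually_elim (use pos in \<open>force simp: indicator_def\<close>)
    then have "emeasure lborel {s. a < s \<and> s < b} = 0"
      by (subst (asm) AE_iff_measurable[OF _ refl]) auto
    moreover have "{s. a < s \<and> s < b} = {a<..<b}" by auto
    ultimately show False using \<open>a < b\<close> by simp
  qed
  moreover have "0 \<le> (LBINT s:{a<..<b}. f s)"
    unfolding set_lebesgue_integral_def by (rule integral_nonneg_AE[OF nn])
  ultimately show ?thesis by simp
qed

lemma continuous_on_zero_of_integral_zero:
  fixes d :: "real \<Rightarrow> real"
  assumes cont: "continuous_on {0..T} d" and zero: "\<And>x. 0 < x \<Longrightarrow> x < T \<Longrightarrow> integral {0..x} d = 0"
    and x: "0 < x" "x < T"
  shows "d x = 0"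
proof -
  have "((\<lambda>y. integral {0..y} d) has_real_derivative d x) (at x within {0..T})"
    using integral_has_real_derivative[OF cont] x by auto
  moreover have "at x within {0..T} = at x" using x by (simp add: at_within_Icc_at)
  ultimately have "((\<lambda>y. integral {0..y} d) has_real_derivative d x) (at x)" by simp
  then have "((\<lambda>y. 0) has_real_derivative d x) (at x)"
    by (rule has_field_derivative_transform_within_open[of _ _ _ "{0<..<T}"]) (use x zero in auto)
  then show ?thesis using DERIV_unique[of "\<lambda>_. 0::real" "d x" x 0] by simp
qed

lemma set_integrable_RL_kernel:
  fixes a x :: real
  assumes a: "0 < a" and "0 < x"
  shows "set_integrable lborel {0<..<x} (\<lambda>r. (x - r) powr (a - 1) / Gamma a)"
proof -
  have eq: "(x - (0 + x * s)) powr (a - 1) / Gamma a =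
    x powr (a - 1) / Gamma a * (s powr (1 - 1) * (1 - s) powr (a - 1))" if "s \<in> {0<..<1}" for s
  proof -
    have "x - (0 + x * s) = x * (1 - s)" by (simp add: algebra_simps)
    then show ?thesis using that by (simp add: powr_mult)
  qed
  have "set_integrable lborel {0<..<0 + x} (\<lambda>r. (x - r) powr (a - 1) / Gamma a)"
    unfolding set_lborel_scale(2)[OF \<open>0 < x\<close>]
    by (subst set_integrable_cong[OF refl refl eq], assumption)
       (intro set_integrable_mult_right set_lborel_Beta a zero_less_one)
  then show ?thesis by simp
qed

lemma continuous_on_bounded_abs:
  fixes u :: "real \<Rightarrow> real"
  assumes "continuous_on {0..T} u"
  obtains B where "0 \<le> B" "\<And>r. 0 \<le> r \<Longrightarrow> r \<le> T \<Longrightarrow> \<bar>u r\<bar> \<le> B"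
proof -
  have "bounded (u ` {0..T})"
    using assms compact_continuous_image compact_imp_bounded by blast
  then obtain B where "\<And>y. y \<in> u ` {0..T} \<Longrightarrow> norm y \<le> B" by (auto simp: bounded_iff)
  then show ?thesis using that[of "max 0 B"] by (auto simp: le_max_iff_disj)
qed

context
  fixes b :: real
  assumes b: "0 < b" "b < 1"
begin

lemma renewal_kernel_integrable: "set_integrable lborel {0<..<1} (\<lambda>s. renewal_kernel b l x s)"
proof -
  have q: "0 < 1 - b" using b by simp
  have eq: "renewal_kernel b l x s = 1 / (Gamma b * Gamma (1 - b)) * (s powr ((1 - b) - 1) * (1 - s) powr (b - 1))
      + l * x powr b / Gamma b * (s powr (1 - 1) * (1 - s) powr (b - 1))" if "s \<in> {0<..<1}" for s
    using that b by (simp add: renewal_kernel_def algebra_simps add_divide_distrib)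
  show ?thesis
    by (subst set_integrable_cong[OF refl refl eq], assumption)
       (intro set_integral_add set_integrable_mult_right set_lborel_Beta q zero_less_one b)
qed

lemma renewal_integrable:
  assumes u: "continuous_on {0..T} u" and x: "0 \<le> x" "x \<le> T"
  shows "set_integrable lborel {0<..<1} (\<lambda>s. renewal_kernel b l x s * u (x * s))"
proof -
  obtain B where B: "\<And>r. 0 \<le> r \<Longrightarrow> r \<le> T \<Longrightarrow> \<bar>u r\<bar> \<le> B"
    using continuous_on_bounded_abs[OF u] by blast
  have xs: "0 \<le> x * s" "x * s \<le> T" if "s \<in> {0<..<1}" for s
    using x that mult_left_mono[of s 1 x] by auto
  have "continuous_on {0<..<1} (\<lambda>s. u (x * s))"
    by (rule continuous_on_compose2[OF u]) (use xs in \<open>auto intro!: continuous_intros\<close>)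
  then show ?thesis
    by (rule set_integrable_mult_bounded[OF renewal_kernel_integrable]) (use B xs in auto)
qed

lemma renewal_kernel_pos:
  assumes "0 \<le> l" "s \<in> {0<..<1}"
  shows "0 < renewal_kernel b l x s"
  unfolding renewal_kernel_def using assms b
  by (intro mult_pos_pos divide_pos_pos add_pos_nonneg) auto

text \<open>Used with \<open>y = x\<close> to compare with the barrier, and with
  \<open>y = T\<close> for a majorant uniform in \<open>x\<close>.\<close>

lemma renewal_kernel_abs_le:
  assumes "s \<in> {0<..<1}" "\<bar>l\<bar> * x powr b \<le> c * y powr b" 
  shows "\<bar>renewal_kernel b l x s\<bar> \<le> renewal_kernel b c y s"
proof -
  have "\<bar>s powr (- b) / Gamma (1 - b) + l * x powr b\<bar> \<le> s powr (- b) / Gamma (1 - b) + \<bar>l\<bar> * x powr b"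
    using b by (intro order.trans[OF abs_triangle_ineq]) (auto simp: abs_mult)
  also have "\<dots> \<le> s powr (- b) / Gamma (1 - b) + c * y powr b" using assms by simp
  finally have "\<bar>(1 - s) powr (b - 1) / Gamma b\<bar> * \<bar>s powr (- b) / Gamma (1 - b) + l * x powr b\<bar>
    \<le> \<bar>(1 - s) powr (b - 1) / Gamma b\<bar> * (s powr (- b) / Gamma (1 - b) + c * y powr b)"
    by (rule mult_left_mono) simp
  then show ?thesis unfolding renewal_kernel_def abs_mult using b assms by simp
qed

lemma continuous_on_renewal:
  assumes u: "continuous_on {0..T} u"
  shows "continuous_on {0..T} (\<lambda>x. LBINT s:{0<..<1}. renewal_kernel b l x s * u (x * s))"
  unfolding continuous_on_sequentially
proof (intro allI ballI impI, elim conjE)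
  fix X :: "nat \<Rightarrow> real" and x
  assume x: "x \<in> {0..T}" and X: "\<forall>n. X n \<in> {0..T}" and lim: "X \<longlonglongrightarrow> x"
  obtain B where B0: "0 \<le> B" and B: "\<And>r. 0 \<le> r \<Longrightarrow> r \<le> T \<Longrightarrow> \<bar>u r\<bar> \<le> B"
    using continuous_on_bounded_abs[OF u] by blast
  have xs: "0 \<le> y * s \<and> y * s \<le> T" if "s \<in> {0<..<1}" "y \<in> {0..T}" for s y
    using that mult_left_mono[of s 1 y] by auto
  let ?g = "\<lambda>y s. indicator {0<..<1} s *\<^sub>R (renewal_kernel b l y s * u (y * s))"
  have int: "integrable lborel (?g y)" if "y \<in> {0..T}" for y
    using renewal_integrable[OF u, of y l] that by (simp add: set_integrable_def)
  have "(\<lambda>n. integral\<^sup>L lborel (?g (X n))) \<longlonglongrightarrow> integral\<^sup>L lborel (?g x)"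
  proof (rule integral_dominated_convergence)
    show "integrable lborel (\<lambda>s. indicator {0<..<1} s *\<^sub>R (renewal_kernel b \<bar>l\<bar> T s * B))"
      using renewal_kernel_integrable[of "\<bar>l\<bar>" T] unfolding set_integrable_def[symmetric] by simp
    show "?g x \<in> borel_measurable lborel" "?g (X n) \<in> borel_measurable lborel" for n
      using int x X by (auto intro: borel_measurable_integrable)
    show "AE s in lborel. (\<lambda>n. ?g (X n) s) \<longlonglongrightarrow> ?g x s"
    proof (intro AE_I2)
      fix s :: real
      show "(\<lambda>n. ?g (X n) s) \<longlonglongrightarrow> ?g x s"
      proof (cases "s \<in> {0<..<1}")
        case True
        have "(\<lambda>n. X n * s) \<longlonglongrightarrow> x * s" by (intro tendsto_intros lim)
        then have 1: "(\<lambda>n. u (X n * s)) \<longlonglongrightarrow> u (x * s)"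
          by (rule continuous_on_tendsto_compose[OF u]) (use xs True x X in auto)
        have 2: "(\<lambda>n. X n powr b) \<longlonglongrightarrow> x powr b"
          by (rule tendsto_powr'[OF lim tendsto_const]) (use X b in auto)
        show ?thesis unfolding renewal_kernel_def
          by (intro tendsto_intros 1 2)
      qed simp
    qed
    show "AE s in lborel. norm (?g (X n) s) \<le> indicator {0<..<1} s *\<^sub>R (renewal_kernel b \<bar>l\<bar> T s * B)" for n
    proof (intro AE_I2)
      fix s :: real
      show "norm (?g (X n) s) \<le> indicator {0<..<1} s *\<^sub>R (renewal_kernel b \<bar>l\<bar> T s * B)"
      proof (cases "s \<in> {0<..<1}")
        case True
        have "X n powr b \<le> T powr b" using X b by (intro powr_mono2) auto
        then have "\<bar>renewal_kernel b l (X n) s\<bar> \<le> renewal_kernel b \<bar>l\<bar> T s"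
          by (intro renewal_kernel_abs_le True mult_left_mono) auto
        moreover have "\<bar>u (X n * s)\<bar> \<le> B" using B xs True X by blast
        ultimately show ?thesis using True
          by (simp add: abs_mult) (intro mult_mono, auto)
      qed simp
    qed
  qed
  then show "((\<lambda>y. LBINT s:{0<..<1}. renewal_kernel b l y s * u (y * s)) \<circ> X)
      \<longlonglongrightarrow> (LBINT s:{0<..<1}. renewal_kernel b l x s * u (x * s))"
    by (simp add: set_lebesgue_integral_def o_def)
qed

text \<open>The kernel for \<open>\<bar>l\<bar>\<close> dominates the absolute value of the one for \<open>l\<close>, so every positive
  multiple of the series for \<open>\<bar>l\<bar>\<close> is a barrier: at the first point where \<open>\<bar>w\<bar>\<close> meets it
  the two renewal equations contradict each other.\<close>

lemma renewal_unique:
  assumes w: "continuous_on {0..T} w" and "w 0 = 0"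
    and eq: "\<And>x. 0 < x \<Longrightarrow> x \<le> T \<Longrightarrow> w x = (LBINT s:{0<..<1}. renewal_kernel b l x s * w (x * s))"
    and x: "0 \<le> x" "x \<le> T"
  shows "w x = 0"
proof -
  let ?E = "sol_series b \<bar>l\<bar>"
  have cE: "continuous_on {0..T} ?E"
    unfolding sol_series_powser
    by (rule continuous_on_subset[OF continuous_on_powser[OF entire_sol_coeff[OF b] b(1)]]) auto
  have E0: "?E 0 = 1"
    by (simp add: sol_series_powser powser_0 sol_coeff_0)
  have lt: "\<bar>w y\<bar> < e * ?E y" if e: "0 < e" and y: "0 \<le> y" "y \<le> T" for e y
  proof (rule ccontr)
    assume "\<not> \<bar>w y\<bar> < e * ?E y"
    let ?d = "\<lambda>y. \<bar>w y\<bar> - e * ?E y"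
    let ?S = "{y \<in> {0..T}. ?d y \<ge> 0}"
    have cd: "continuous_on {0..T} ?d" by (intro continuous_intros w cE)
    have "closed ?S"
      by (intro continuous_on_closed_Collect_le cd continuous_on_const) simp
    have ne: "?S \<noteq> {}" using y \<open>\<not> \<bar>w y\<bar> < e * ?E y\<close> by auto
    have bdd: "bdd_below ?S" by (rule bdd_belowI[of _ 0]) auto
    define z where "z = Inf ?S"
    have zS: "z \<in> ?S" unfolding z_def by (rule closed_contains_Inf[OF ne bdd \<open>closed ?S\<close>])
    \<comment> \<open>At 0 the barrier is strictly above: \<open>w\<close> vanishes there and the
      barrier equals \<open>e\<close>.\<close>
    have "z \<noteq> 0" using zS \<open>w 0 = 0\<close> E0 e by auto
    then have z: "0 < z" "z \<le> T" using zS by auto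
    have below: "\<bar>w r\<bar> < e * ?E r" if "0 \<le> r" "r < z" for r
      using cInf_lower[OF _ bdd, of r] that z unfolding z_def[symmetric] by force
    let ?K = "renewal_kernel b \<bar>l\<bar> z"
    have cw: "continuous_on {0..T} (\<lambda>r. \<bar>w r\<bar>)" by (intro continuous_intros w)
    have iw: "set_integrable lborel {0<..<1} (\<lambda>s. ?K s * \<bar>w (z * s)\<bar>)"
      using renewal_integrable[OF cw, of z] z by simp
    have iE: "set_integrable lborel {0<..<1} (\<lambda>s. ?K s * ?E (z * s))"
      using renewal_integrable[OF cE, of z] z by simp
    have iK: "set_integrable lborel {0<..<1} (\<lambda>s. renewal_kernel b l z s * w (z * s))"
      using renewal_integrable[OF w, of z] z by simp
    have "\<bar>w z\<bar> = \<bar>LBINT s:{0<..<1}. renewal_kernel b l z s * w (z * s)\<bar>"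
      using eq[OF z] by simp
    also have "\<dots> \<le> (LBINT s:{0<..<1}. \<bar>renewal_kernel b l z s * w (z * s)\<bar>)"
      using set_integral_norm_bound[OF iK] by simp
    also have "\<dots> \<le> (LBINT s:{0<..<1}. ?K s * \<bar>w (z * s)\<bar>)"
    proof (rule set_integral_mono[OF _ iw])
      show "set_integrable lborel {0<..<1} (\<lambda>s. \<bar>renewal_kernel b l z s * w (z * s)\<bar>)"
        using set_integrable_abs[OF iK] .
      fix s :: real assume "s \<in> {0<..<1}"
      then show "\<bar>renewal_kernel b l z s * w (z * s)\<bar> \<le> ?K s * \<bar>w (z * s)\<bar>"
        unfolding abs_mult by (intro mult_right_mono renewal_kernel_abs_le) auto
    qed
    finally have up: "\<bar>w z\<bar> \<le> (LBINT s:{0<..<1}. ?K s * \<bar>w (z * s)\<bar>)" .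
    \<comment> \<open>Strictness at \<open>z\<close> comes from strictness at all earlier points,
      since the kernel for \<open>|l|\<close> is positive.\<close>
    have "0 < (LBINT s:{0<..<1}. e * (?K s * ?E (z * s)) - ?K s * \<bar>w (z * s)\<bar>)"
    proof (rule set_integral_pos)
      show "set_integrable lborel {0<..<1} (\<lambda>s. e * (?K s * ?E (z * s)) - ?K s * \<bar>w (z * s)\<bar>)"
        by (intro set_integral_diff set_integrable_mult_right iE iw)
      fix s :: real assume s: "s \<in> {0<..<1}"
      then have "\<bar>w (z * s)\<bar> < e * ?E (z * s)" using z by (intro below) auto
      from mult_strict_left_mono[OF this renewal_kernel_pos[of "\<bar>l\<bar>" s z]] s
      show "0 < e * (?K s * ?E (z * s)) - ?K s * \<bar>w (z * s)\<bar>" by (simp add: mult_ac)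
    qed simp
    also have "\<dots> = e * (LBINT s:{0<..<1}. ?K s * ?E (z * s)) - (LBINT s:{0<..<1}. ?K s * \<bar>w (z * s)\<bar>)"
      by (subst set_integral_diff(2)) (auto intro!: set_integrable_mult_right iE iw)
    also have "(LBINT s:{0<..<1}. ?K s * ?E (z * s)) = ?E z"
      using sol_series_renewal(2)[OF b, of z "\<bar>l\<bar>"] z by simp
    finally have "\<bar>w z\<bar> < e * ?E z" using up by simp
    then show False using zS by auto
  qed
  show ?thesis
  proof (rule ccontr)
    assume "w x \<noteq> 0"
    have "0 < \<bar>?E x\<bar> + 1" by (simp add: add_nonneg_pos)
    \<comment> \<open>This \<open>e\<close> gives \<open>e * ?E x <= |w x|\<close>, against
      \<open>lt\<close>; adding 1 avoids a division by zero without knowing the size of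
      \<open>?E x\<close>.\<close>
    then have "0 < \<bar>w x\<bar> / (\<bar>?E x\<bar> + 1)" using \<open>w x \<noteq> 0\<close> by simp
    note lt[OF this x]
    also have "\<bar>w x\<bar> / (\<bar>?E x\<bar> + 1) * ?E x \<le> \<bar>w x\<bar> / (\<bar>?E x\<bar> + 1) * (\<bar>?E x\<bar> + 1)"
      by (intro mult_left_mono) auto
    also have "\<dots> = \<bar>w x\<bar>" using \<open>0 < \<bar>?E x\<bar> + 1\<close> by simp
    finally show False by simp
  qed
qed

end

subsection \<open>From the differential equation to the renewal equation\<close>

context
  fixes b :: real
  assumes b: "0 < b" "b < 1"
begin

lemma forcing_integrable:
  fixes u :: "real \<Rightarrow> real"
  assumes u: "continuous_on {0..T} u" and x: "0 < x" "x \<le> T"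
  shows "set_integrable lborel {0<..<x} (\<lambda>r. (r powr (- b) / Gamma (1 - b) + l) * u r)"
proof -
  obtain B where B: "\<And>r. 0 \<le> r \<Longrightarrow> r \<le> T \<Longrightarrow> \<bar>u r\<bar> \<le> B"
    using continuous_on_bounded_abs[OF u] by blast
  have "((\<lambda>r. r powr (- b)) has_integral (x powr (- b + 1) / (- b + 1))) {0..x}"
    by (rule has_integral_powr_from_0) (use b x in auto)
  moreover have "continuous_on {0<..<x} (\<lambda>r. r powr (- b))" by (intro continuous_intros) auto
  ultimately have "set_integrable lborel {0<..<x} (\<lambda>r. r powr (- b))"
    by (rule set_lborel_of_has_integral_nonneg) simp
  moreover have "set_integrable lborel {0<..<x} (\<lambda>r. l)"
    by (rule set_integrable_subset[OF borel_integrable_atLeastAtMost'[of 0 x, OF continuous_on_const]]) auto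
  ultimately have "set_integrable lborel {0<..<x} (\<lambda>r. r powr (- b) / Gamma (1 - b) + l)"
    by (intro set_integral_add set_integrable_divide)
  then show ?thesis
    by (rule set_integrable_mult_bounded[where B = B, OF _ continuous_on_subset[OF u]]) (use B x in auto)
qed

text \<open>Supplies the boundary value: for bounded \<open>u\<close> the Riemann-Liouville integral
  vanishes like \<open>x^a\<close> at 0.\<close>

lemma RL_integral_bound:
  fixes u :: "real \<Rightarrow> real"
  assumes u: "continuous_on {0..T} u" and B: "\<And>r. 0 \<le> r \<Longrightarrow> r \<le> T \<Longrightarrow> \<bar>u r\<bar> \<le> B"
    and x: "0 < x" "x \<le> T" and a: "0 < a"
  shows "\<bar>RL_integral a u x\<bar> \<le> x powr a * (B * (LBINT s:{0<..<1}. (1 - s) powr (a - 1) / Gamma a))"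
proof -
  let ?k = "\<lambda>s. (1 - s) powr (a - 1) / Gamma a"
  have k: "set_integrable lborel {0<..<1} ?k"
    using set_integrable_RL_kernel[OF a, of 1] by simp
  have xs: "0 \<le> x * s \<and> x * s \<le> T" if "s \<in> {0<..<1}" for s
  proof -
    have "x * s \<le> x * 1" by (rule mult_left_mono) (use that x in auto)
    also have "\<dots> \<le> T" using x by simp
    finally show ?thesis using that x by simp
  qed
  have c: "continuous_on {0<..<1} (\<lambda>s. u (x * s))"
    by (rule continuous_on_compose2[OF u]) (use xs in \<open>auto intro!: continuous_intros\<close>)
  have i: "set_integrable lborel {0<..<1} (\<lambda>s. ?k s * u (x * s))"
    by (rule set_integrable_mult_bounded[where B = B, OF k c]) (use B xs in auto)
  have "\<bar>LBINT s:{0<..<1}. ?k s * u (x * s)\<bar> \<le> (LBINT s:{0<..<1}. \<bar>?k s * u (x * s)\<bar>)"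
    using set_integral_norm_bound[OF i] by simp
  also have "\<dots> \<le> (LBINT s:{0<..<1}. B * ?k s)"
  proof (rule set_integral_mono)
    show "set_integrable lborel {0<..<1} (\<lambda>s. \<bar>?k s * u (x * s)\<bar>)"
      by (rule set_integrable_abs[OF i])
    show "set_integrable lborel {0<..<1} (\<lambda>s. B * ?k s)"
      by (intro set_integrable_mult_right k)
    fix s :: real assume s: "s \<in> {0<..<1}"
    have "0 \<le> ?k s" using a by simp
    then have "\<bar>?k s * u (x * s)\<bar> = \<bar>u (x * s)\<bar> * ?k s"
      by (simp only: abs_mult abs_of_nonneg mult.commute)
    also have "\<dots> \<le> B * ?k s"
      by (rule mult_right_mono) (use B xs[OF s] \<open>0 \<le> ?k s\<close> in auto)
    finally show "\<bar>?k s * u (x * s)\<bar> \<le> B * ?k s" .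
  qed
  finally have le: "\<bar>LBINT s:{0<..<1}. ?k s * u (x * s)\<bar> \<le> B * (LBINT s:{0<..<1}. ?k s)"
    by (simp only: set_integral_mult_right)
  have "\<bar>RL_integral a u x\<bar> = x powr a * \<bar>LBINT s:{0<..<1}. ?k s * u (x * s)\<bar>"
    by (simp only: RL_integral_scale[OF x(1)] abs_mult abs_of_nonneg[OF powr_ge_zero])
  also have "\<dots> \<le> x powr a * (B * (LBINT s:{0<..<1}. ?k s))"
    using le by (rule mult_left_mono) simp
  finally show ?thesis .
qed

text \<open>The differential equation integrated from 0; no constant of integration appears because
  the left side tends to 0 there.\<close>

lemma solves_on_RL_integral:
  assumes sol: "solves_on b l u0 T u" and x: "0 < x" "x \<le> T"
  shows "RL_integral (1 - b) u x = (LBINT r:{0<..<x}. (r powr (- b) / Gamma (1 - b) + l) * u r)"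
proof -
  let ?R = "RL_integral (1 - b) u" and ?f = "\<lambda>r. (r powr (- b) / Gamma (1 - b) + l) * u r"
  have u: "continuous_on {0..T} u"
    using sol by (simp add: solves_on_def C_beta_Icc_def)
  have "?R \<in> C1_Ioc T"
    using sol by (simp add: solves_on_def C_beta_Icc_def C_beta_Ioc_def)
  then obtain R' where R': "\<And>y. y \<in> {0<..T} \<Longrightarrow> (?R has_real_derivative R' y) (at y within {0<..T})"
    unfolding C1_Ioc_def by blast
  have der: "(?R has_vector_derivative ?f y) (at y within {0<..T})" if y: "y \<in> {0<..T}" for y
  proof -
    have R: "(?R has_vector_derivative R' y) (at y within {0<..T})"
      using R'[OF y] by (simp add: has_real_derivative_iff_has_vector_derivative)
    \<comment> \<open>Approach from the left is possible even at \<open>y = T\<close>, so the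
      one-sided \<open>vector_derivative\<close> is determined uniquely.\<close>
    have "y islimpt {0<..<y}" using y by (intro islimpt_greaterThanLessThan2) auto
    then have "y islimpt {0<..T}" by (rule islimpt_subset) (use y in auto)
    then have "at y within {0<..T} \<noteq> bot" by (simp add: trivial_limit_within)
    then have "vector_derivative ?R (at y within {0<..T}) = R' y"
      using R by (rule vector_derivative_within)
    moreover have "censored_deriv b T u y = l * u y" using sol y by (simp add: solves_on_def)
    ultimately have "R' y = ?f y"
      using y by (simp add: censored_deriv_def algebra_simps)
    with R show ?thesis by simp
  qed
  obtain B where B: "\<And>r. 0 \<le> r \<Longrightarrow> r \<le> T \<Longrightarrow> \<bar>u r\<bar> \<le> B"
    using continuous_on_bounded_abs[OF u] by blast
  \<comment> \<open>The value at 0 is an integral over the empty set; it agrees with the limit from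
    the right, so \<open>?R\<close> is continuous on the closed interval.\<close>
  have R0: "?R 0 = 0" by (simp add: RL_integral_def set_lebesgue_integral_def)
  have q: "0 < 1 - b" using b by simp
  have "continuous (at y within {0..x}) ?R" if y: "y \<in> {0..x}" for y
  proof (cases "y = 0")
    case True
    let ?C = "B * (LBINT s:{0<..<1}. (1 - s) powr (1 - b - 1) / Gamma (1 - b))"
    have "((\<lambda>y. y powr (1 - b) * ?C) \<longlongrightarrow> 0 powr (1 - b) * ?C) (at 0 within {0..x})"
      by (intro tendsto_mult tendsto_const tendsto_powr'[OF tendsto_ident_at])
         (use q in \<open>auto simp: eventually_at_filter\<close>)
    then have lim: "((\<lambda>y. y powr (1 - b) * ?C) \<longlongrightarrow> 0) (at 0 within {0..x})" by simp
    have "(?R \<longlongrightarrow> 0) (at 0 within {0..x})"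
    proof (rule Lim_null_comparison[OF _ lim])
      show "\<forall>\<^sub>F y in at 0 within {0..x}. norm (?R y) \<le> y powr (1 - b) * ?C"
        unfolding eventually_at_filter
        by (intro always_eventually allI impI) (use RL_integral_bound[OF u B _ _ q] x in auto)
    qed
    then show ?thesis by (simp add: True continuous_within R0)
  next
    case False
    then have y': "y \<in> {0<..T}" using y x by auto
    have "continuous (at y within {0<..T}) ?R"
      using der[OF y'] by (rule has_vector_derivative_continuous)
    moreover have "at y within {0..x} = at y within {0<..x}"
      by (rule at_within_nhd[of y "{0<..}"]) (use y False in auto)
    moreover have "{0<..x} \<subseteq> {0<..T}" using x by auto
    ultimately show ?thesis by (metis continuous_within_subset)
  qed
  then have "continuous_on {0..x} ?R" by (simp add: continuous_on_eq_continuous_within)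
  moreover have "(?R has_vector_derivative ?f y) (at y)" if y: "y \<in> {0<..<x}" for y
  proof -
    have "at y within {0<..T} = at y"
      by (rule at_within_interior, rule interiorI[of "{0<..<T}"]) (use y x in auto)
    then show ?thesis using der[of y] y x by simp
  qed
  ultimately have "(?f has_integral (?R x - ?R 0)) {0..x}"
    using x by (intro fundamental_theorem_of_calculus_interior) auto
  then have "(?f has_integral ?R x) {0<..<x}" by (simp add: R0 has_integral_Icc_iff_Ioo)
  then show ?thesis
    using set_borel_integral_eq_integral(2)[OF forcing_integrable[OF u x]] by (simp add: integral_unique)
qed

text \<open>Write J^a for the integral of order \<open>a\<close>. The right side is
  \<open>g = J^b f\<close>, and \<open>J^(1-b) (g - u) = 0\<close> because both terms equal the
  integral of \<open>f\<close>. Applying \<open>J^b\<close> shows that \<open>g - u\<close> has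
  vanishing primitive, hence is 0. Thus no differentiation of \<open>u\<close> is required.\<close>

lemma solves_on_renewal:
  assumes sol: "solves_on b l u0 T u" and x: "0 < x" "x < T"
  shows "u x = (LBINT s:{0<..<1}. renewal_kernel b l x s * u (x * s))"
proof -
  let ?f = "\<lambda>r. (r powr (- b) / Gamma (1 - b) + l) * u r"
  define g where "g y = (LBINT s:{0<..<1}. renewal_kernel b l y s * u (y * s))" for y
  have u: "continuous_on {0..T} u"
    using sol by (simp add: solves_on_def C_beta_Icc_def)
  have g: "continuous_on {0..T} g"
    unfolding g_def by (rule continuous_on_renewal[OF b u])
  have q: "0 < 1 - b" "1 - b < 1" using b by auto
  have gR: "RL_integral b ?f y = g y" if y: "0 < y" for y
  proof -
    have "RL_integral b ?f y =
      (LBINT s:{0<..<1}. y powr b * ((1 - s) powr (b - 1) / Gamma b * ?f (y * s)))"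
      unfolding RL_integral_scale[OF y] by (rule set_integral_mult_right[symmetric])
    also have "\<dots> = g y"
      unfolding g_def
    proof (rule set_integral_cong_on)
      fix s :: real assume s: "s \<in> {0<..<1}"
      then have "y powr b * (y * s) powr (- b) = s powr (- b)"
        using y by (simp add: powr_mult powr_minus field_simps)
      then have "y powr b * ((y * s) powr (- b) / Gamma (1 - b) + l) = s powr (- b) / Gamma (1 - b) + l * y powr b"
        by (simp add: algebra_simps)
      then have "renewal_kernel b l y s * u (y * s) =
        (1 - s) powr (b - 1) / Gamma b * (y powr b * ((y * s) powr (- b) / Gamma (1 - b) + l)) * u (y * s)"
        by (simp add: renewal_kernel_def)
      then show "y powr b * ((1 - s) powr (b - 1) / Gamma b * ?f (y * s)) = renewal_kernel b l y s * u (y * s)"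
        by (simp only: mult_ac)
    qed
    finally show ?thesis .
  qed
  let ?d = "\<lambda>y. g y - u y"
  have d: "continuous_on {0..T} ?d" by (intro continuous_intros g u)
  have RLint: "set_integrable lborel {0<..<y} (\<lambda>r. (y - r) powr (1 - b - 1) / Gamma (1 - b) * w r)"
    if w: "continuous_on {0..T} w" and y: "0 < y" "y \<le> T" for w y
  proof -
    obtain B where B: "\<And>r. 0 \<le> r \<Longrightarrow> r \<le> T \<Longrightarrow> \<bar>w r\<bar> \<le> B"
      using continuous_on_bounded_abs[OF w] by blast
    show ?thesis
      by (rule set_integrable_mult_bounded[where B = B, OF set_integrable_RL_kernel[OF q(1) y(1)] continuous_on_subset[OF w]])
         (use B y in auto)
  qed
  have zero: "RL_integral (1 - b) ?d y = 0" if y: "0 < y" "y \<le> T" for y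
  proof -
    have "RL_integral (1 - b) ?d y = RL_integral (1 - b) g y - RL_integral (1 - b) u y"
      unfolding RL_integral_def right_diff_distrib
      by (rule set_integral_diff(2)) (intro RLint g u y)+
    also have "RL_integral (1 - b) g y = RL_integral (1 - b) (RL_integral b ?f) y"
      unfolding RL_integral_def[of "1 - b"] by (rule set_integral_cong_on) (simp add: gR)
    also have "\<dots> = (LBINT r:{0<..<y}. ?f r)"
      using RL_integral_RL_integral[OF q forcing_integrable[OF u y]] by simp
    also have "RL_integral (1 - b) u y = (LBINT r:{0<..<y}. ?f r)"
      by (rule solves_on_RL_integral[OF sol y])
    finally show ?thesis by simp
  qed
  have "integral {0..y} ?d = 0" if y: "0 < y" "y < T" for y
  proof -
    have i: "set_integrable lborel {0<..<y} ?d"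
      by (rule set_integrable_subset[OF borel_integrable_atLeastAtMost'[of 0 y, OF continuous_on_subset[OF d]]]) (use y in auto)
    have "integral {0..y} ?d = (LBINT s:{0<..<y}. ?d s)"
      unfolding set_borel_integral_eq_integral(2)[OF i] by (simp add: integral_open_interval_real)
    also have "\<dots> = RL_integral b (RL_integral (1 - b) ?d) y"
      by (rule RL_integral_RL_integral[OF b i, symmetric])
    also have "\<dots> = (LBINT r:{0<..<y}. (y - r) powr (b - 1) / Gamma b * 0)"
      unfolding RL_integral_def[of b] using y by (intro set_integral_cong_on) (simp add: zero)
    finally show ?thesis by simp
  qed
  from continuous_on_zero_of_integral_zero[OF d this x] show ?thesis by (simp add: g_def)
qed

lemma solution_eq_series:
  assumes sol: "solution b l u0 u" and x: "0 \<le> x"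
  shows "u x = u0 * sol_series b l x"
proof -
  let ?T = "x + 1" and ?F = "sol_series b l"
  \<comment> \<open>The renewal equation is known strictly below the right end only; solving up to
    \<open>x + 2\<close> makes it valid on all of \<open>(0, x + 1]\<close>.\<close>
  have sT: "solves_on b l u0 (x + 2) u" using sol x by (simp add: solution_def)
  have u: "continuous_on {0..?T} u"
    using sT by (auto simp: solves_on_def C_beta_Icc_def intro: continuous_on_subset)
  have F: "continuous_on {0..?T} ?F"
    unfolding sol_series_powser
    by (rule continuous_on_subset[OF continuous_on_powser[OF entire_sol_coeff[OF b] b(1)]]) auto
  let ?w = "\<lambda>y. u y - u0 * ?F y"
  have "?w x = 0"
  proof (rule renewal_unique[OF b, of ?T ?w l])
    show "continuous_on {0..?T} ?w" by (intro continuous_intros u F)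
    show "?w 0 = 0"
      using sT by (simp add: solves_on_def sol_series_powser powser_0 sol_coeff_0)
    fix y assume y: "0 < y" "y \<le> ?T"
    have "u y - u0 * ?F y = (LBINT s:{0<..<1}. renewal_kernel b l y s * u (y * s)) -
        u0 * (LBINT s:{0<..<1}. renewal_kernel b l y s * ?F (y * s))"
      using solves_on_renewal[OF sT, of y] sol_series_renewal(2)[OF b, of y l] y by simp
    also have "\<dots> = (LBINT s:{0<..<1}. renewal_kernel b l y s * u (y * s)) -
        (LBINT s:{0<..<1}. u0 * (renewal_kernel b l y s * ?F (y * s)))"
      by (simp only: set_integral_mult_right)
    also have "\<dots> = (LBINT s:{0<..<1}. renewal_kernel b l y s * u (y * s) - u0 * (renewal_kernel b l y s * ?F (y * s)))"
      by (rule set_integral_diff(2)[symmetric])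
         (use y renewal_integrable[OF b u] renewal_integrable[OF b F] in \<open>auto intro!: set_integrable_mult_right\<close>)
    finally show "?w y = (LBINT s:{0<..<1}. renewal_kernel b l y s * ?w (y * s))"
      by (simp add: algebra_simps)
  qed (use x in auto)
  then show ?thesis by simp
qed

end

subsection \<open>Complete monotonicity\<close>

text \<open>\<open>taylor b a n x\<close> is \<open>x\<^sup>n / n!\<close> times the \<open>n\<close>-th derivative of \<open>powser b a\<close>.\<close>

definition taylor :: "real \<Rightarrow> (nat \<Rightarrow> real) \<Rightarrow> nat \<Rightarrow> real \<Rightarrow> real" where
  "taylor b a n = powser b (\<lambda>N. (b * real N gchoose n) * a N)"

lemma taylor_0: "taylor b a 0 = powser b a"
  by (simp add: taylor_def)

lemma gbinomial_Suc_eq: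
  fixes p :: real
  shows "(p gchoose Suc n) = (p - real n) * (p gchoose n) / real (Suc n)"
  using gbinomial_mult_1[of p n] by (simp add: field_simps)

text \<open>For fixed \<open>n\<close> the binomial is a polynomial in \<open>N\<close>; each step
  of the recursion multiplies by an affine function of \<open>N\<close>.\<close>

lemma entire_taylor:
  assumes "entire a"
  shows "entire (\<lambda>N. (b * real N gchoose n) * a N)"
proof (induction n)
  case (Suc n)
  let ?c = "\<lambda>N. (b * real N gchoose n) * a N"
  have "entire (\<lambda>N. (b / real (Suc n)) * (real N * ?c N) + (- real n / real (Suc n)) * ?c N)"
    by (intro entire_add entire_cmult entire_mult_of_nat Suc)
  also have "(\<lambda>N. (b / real (Suc n)) * (real N * ?c N) + (- real n / real (Suc n)) * ?c N) =
    (\<lambda>N. (b * real N gchoose Suc n) * a N)"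
    unfolding gbinomial_Suc_eq by (simp add: fun_eq_iff divide_simps) (simp add: algebra_simps)
  finally show ?case .
qed (use assms in simp)

lemma powser_has_real_derivative:
  assumes c: "entire c" and x: "0 < x"
  shows "(powser b c has_real_derivative powser b (\<lambda>N. b * real N * c N) x / x) (at x)"
proof -
  let ?z = "x powr b"
  have s: "summable (\<lambda>N. c N * z ^ N)" for z using c by (simp add: entire_def)
  have sd: "summable (\<lambda>N. diffs c N * z ^ N)" for z by (rule termdiff_converges_all[OF s])
  let ?D = "\<Sum>N. diffs c N * ?z ^ N"
  have "((\<lambda>z. \<Sum>N. c N * z ^ N) has_real_derivative ?D) (at ?z)"
    by (rule termdiffs_strong_converges_everywhere[OF s])
  moreover have "((\<lambda>x. x powr b) has_real_derivative b * x powr (b - 1)) (at x)"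
    using x by (rule has_real_derivative_powr)
  ultimately have "((\<lambda>x. \<Sum>N. c N * (x powr b) ^ N) has_real_derivative ?D * (b * x powr (b - 1))) (at x)"
    by (rule DERIV_chain2)
  \<comment> \<open>\<open>N - Suc 0\<close> truncates at \<open>N = 0\<close>, where the factor
    \<open>real N\<close> kills the term.\<close>
  moreover have "(\<lambda>N. (b * ?z) * (real N * c N * ?z ^ (N - Suc 0))) sums ((b * ?z) * ?D)"
    by (intro sums_mult diffs_equiv sd)
  then have "(\<lambda>N. b * real N * c N * ?z ^ N) sums ((b * ?z) * ?D)"
  proof (rule back_subst[of "\<lambda>f. f sums _"])
    show "(\<lambda>N. (b * ?z) * (real N * c N * ?z ^ (N - Suc 0))) = (\<lambda>N. b * real N * c N * ?z ^ N)"
    proof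
      fix N show "(b * ?z) * (real N * c N * ?z ^ (N - Suc 0)) = b * real N * c N * ?z ^ N"
        by (cases N) auto
    qed
  qed
  then have "powser b (\<lambda>N. b * real N * c N) x = b * ?z * ?D"
    by (simp add: powser_def sums_iff)
  then have "?D * (b * x powr (b - 1)) = powser b (\<lambda>N. b * real N * c N) x / x"
    using x by (simp add: powr_diff)
  ultimately show ?thesis by (simp add: powser_def[abs_def])
qed

text \<open>With \<open>p = b N\<close> this is \<open>p C(p,n) = n C(p,n) + (n+1) C(p,n+1)\<close>,
  the coefficient form of the product rule for \<open>x d/dx\<close> applied to
  \<open>x^n u^(n) / n!\<close>.\<close>

lemma taylor_step:
  assumes a: "entire a"
  shows "powser b (\<lambda>N. b * real N * ((b * real N gchoose n) * a N)) x =
    real n * taylor b a n x + real (Suc n) * taylor b a (Suc n) x"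
proof -
  let ?z = "x powr b"
  have "(\<lambda>N. real n * ((b * real N gchoose n) * a N * ?z ^ N) + real (Suc n) * ((b * real N gchoose Suc n) * a N * ?z ^ N)) sums
    (real n * taylor b a n x + real (Suc n) * taylor b a (Suc n) x)"
    unfolding taylor_def by (intro sums_add sums_mult powser_sums entire_taylor a)
  also have "(\<lambda>N. real n * ((b * real N gchoose n) * a N * ?z ^ N) + real (Suc n) * ((b * real N gchoose Suc n) * a N * ?z ^ N)) =
    (\<lambda>N. b * real N * ((b * real N gchoose n) * a N) * ?z ^ N)"
  proof
    fix N
    have "real (Suc n) * (b * real N gchoose Suc n) = (b * real N - real n) * (b * real N gchoose n)"
      by (simp add: gbinomial_Suc_eq)
    then have "real (Suc n) * ((b * real N gchoose Suc n) * a N * ?z ^ N) =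
      (b * real N - real n) * (b * real N gchoose n) * a N * ?z ^ N"
      by (metis mult.assoc)
    then show "real n * ((b * real N gchoose n) * a N * ?z ^ N) + real (Suc n) * ((b * real N gchoose Suc n) * a N * ?z ^ N) =
      b * real N * ((b * real N gchoose n) * a N) * ?z ^ N"
      by (simp add: algebra_simps)
  qed
  finally show ?thesis by (simp add: powser_def sums_iff)
qed

text \<open>\<open>u\<close> is known only on the positive axis, so each derivative is transferred
  from the explicit formula within that open set.\<close>

lemma deriv_iterate_powser:
  assumes a: "entire a" and u: "\<And>x. 0 < x \<Longrightarrow> u x = c * powser b a x" and x: "0 < x"
  shows "(deriv ^^ n) u x = c * (fact n * taylor b a n x / x ^ n)"
    and "((deriv ^^ n) u has_real_derivative c * (fact (Suc n) * taylor b a (Suc n) x / x ^ Suc n)) (at x)"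
proof -
  have step: "((deriv ^^ n) u has_real_derivative c * (fact (Suc n) * taylor b a (Suc n) x / x ^ Suc n)) (at x)"
    if IH: "\<And>x. 0 < x \<Longrightarrow> (deriv ^^ n) u x = c * (fact n * taylor b a n x / x ^ n)" and x: "0 < x" for n x
  proof -
    have d: "(taylor b a n has_real_derivative
        (real n * taylor b a n x + real (Suc n) * taylor b a (Suc n) x) / x) (at x)"
      using powser_has_real_derivative[OF entire_taylor[OF a] x, of b b n]
      unfolding taylor_step[OF a] taylor_def[symmetric] .
    have "((\<lambda>x. c * (fact n * taylor b a n x / x ^ n)) has_real_derivative
        c * (fact (Suc n) * taylor b a (Suc n) x / x ^ Suc n)) (at x)"
    proof (rule DERIV_cong)
      show "((\<lambda>x. c * (fact n * taylor b a n x / x ^ n)) has_real_derivative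
        c * ((fact n * ((real n * taylor b a n x + real (Suc n) * taylor b a (Suc n) x) / x) * x ^ n -
          fact n * taylor b a n x * (real n * x ^ (n - Suc 0))) / (x ^ n * x ^ n))) (at x)"
        using x by (intro DERIV_cmult DERIV_divide d) (auto intro!: derivative_eq_intros)
      show "c * ((fact n * ((real n * taylor b a n x + real (Suc n) * taylor b a (Suc n) x) / x) * x ^ n -
          fact n * taylor b a n x * (real n * x ^ (n - Suc 0))) / (x ^ n * x ^ n)) =
        c * (fact (Suc n) * taylor b a (Suc n) x / x ^ Suc n)"
        using x by (cases n) (simp_all add: field_simps)
    qed
    then show ?thesis
      by (rule has_field_derivative_transform_within_open[of _ _ _ "{0<..}"]) (use x IH in auto)
  qed
  have val: "(deriv ^^ n) u x = c * (fact n * taylor b a n x / x ^ n)" if "0 < x" for n x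
    using that
  proof (induction n arbitrary: x)
    case 0
    then show ?case by (simp add: u taylor_0)
  next
    case (Suc n)
    show ?case using DERIV_imp_deriv[OF step[OF Suc.IH Suc.prems]] by simp
  qed
  show "(deriv ^^ n) u x = c * (fact n * taylor b a n x / x ^ n)" by (rule val[OF x])
  show "((deriv ^^ n) u has_real_derivative c * (fact (Suc n) * taylor b a (Suc n) x / x ^ Suc n)) (at x)"
    by (rule step[OF val x])
qed

text \<open>These are the coefficients of \<open>(1 - t)^b\<close> after the constant one. The first
  is \<open>- b\<close>, and each later ratio \<open>(k - b) / (k + 1)\<close>,
  \<open>k >= 1\<close>, is positive.\<close>

lemma gbinomial_alternating_nonpos:
  fixes b :: real
  assumes "0 < b" "b < 1"
  shows "(- 1) ^ Suc k * (b gchoose Suc k) \<le> 0"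
proof (induction k)
  case (Suc k)
  have "(- 1) ^ Suc (Suc k) * (b gchoose Suc (Suc k)) =
    ((real (Suc k) - b) / real (Suc (Suc k))) * ((- 1) ^ Suc k * (b gchoose Suc k))"
    unfolding gbinomial_Suc_eq[of b "Suc k"] by (simp add: field_simps)
  also have "\<dots> \<le> 0"
    by (rule mult_nonneg_nonpos[OF _ Suc.IH]) (use assms in simp)
  finally show ?case .
qed (use assms in simp)

section \<open>The nonlocal equation for derivatives and its minimum principle\<close>

context
  fixes b l :: real
  assumes b: "0 < b" "b < 1"
begin

text \<open>Leibniz's rule for \<open>x^n d^n / n!\<close> applied to \<open>x^b F\<close>. On
  coefficients it is Vandermonde's identity for \<open>b (M + 1) = b M + b\<close>.\<close>

lemma levy_taylor:
  assumes x: "0 \<le> x"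
  shows "(LBINT s:{0<..<1}. levy_density b s * (taylor b (sol_coeff b l) n x - taylor b (sol_coeff b l) n (x * s))) =
    l * x powr b * (\<Sum>j=0..n. (b gchoose (n - j)) * taylor b (sol_coeff b l) j x)"
proof -
  let ?a = "sol_coeff b l" and ?z = "x powr b"
  note a = entire_sol_coeff[OF b, of l]
  have "(\<lambda>M. l * ?z * (\<Sum>j=0..n. (b gchoose (n - j)) * ((b * real M gchoose j) * ?a M * ?z ^ M))) sums
      (l * ?z * (\<Sum>j=0..n. (b gchoose (n - j)) * taylor b ?a j x))"
    unfolding taylor_def by (intro sums_mult sums_sum powser_sums entire_taylor a)
  also have "(\<lambda>M. l * ?z * (\<Sum>j=0..n. (b gchoose (n - j)) * ((b * real M gchoose j) * ?a M * ?z ^ M))) =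
    (\<lambda>M. eigenvalue b (Suc M) * ((b * real (Suc M) gchoose n) * ?a (Suc M)) * ?z ^ Suc M)"
  proof
    fix M
    have "(\<Sum>j=0..n. (b gchoose (n - j)) * ((b * real M gchoose j) * ?a M * ?z ^ M)) =
      (\<Sum>j=0..n. (b * real M gchoose j) * (b gchoose (n - j))) * (?a M * ?z ^ M)"
      unfolding sum_distrib_right by (intro sum.cong) auto
    also have "\<dots> = (b * real (Suc M) gchoose n) * (?a M * ?z ^ M)"
      unfolding gbinomial_Vandermonde by (simp add: algebra_simps)
    finally have "l * ?z * (\<Sum>j=0..n. (b gchoose (n - j)) * ((b * real M gchoose j) * ?a M * ?z ^ M)) =
      (l * ?a M) * (b * real (Suc M) gchoose n) * ?z ^ Suc M" by simp
    then show "l * ?z * (\<Sum>j=0..n. (b gchoose (n - j)) * ((b * real M gchoose j) * ?a M * ?z ^ M)) =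
      eigenvalue b (Suc M) * ((b * real (Suc M) gchoose n) * ?a (Suc M)) * ?z ^ Suc M"
      unfolding sol_coeff_Suc[OF b, symmetric] by (simp only: mult_ac)
  qed
  finally have "(\<lambda>N. eigenvalue b N * ((b * real N gchoose n) * ?a N) * ?z ^ N) sums
    (l * ?z * (\<Sum>j=0..n. (b gchoose (n - j)) * taylor b ?a j x) + eigenvalue b 0 * ((b * real 0 gchoose n) * ?a 0) * ?z ^ 0)"
    by (rule sums_Suc)
  then show ?thesis
    using powser_levy(2)[OF b entire_taylor[OF a] x, of b n] unfolding taylor_def
    by (simp add: eigenvalue_0 sums_iff)
qed

text \<open>Since \<open>x\<^sup>n \<partial>\<^sup>n\<close> commutes with dilations, at a negative minimum of \<open>(- 1)\<^sup>n taylor b a n\<close>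
  the integral in \<open>levy_taylor\<close> has one sign, whereas the terms of lower order on the other side
  have the opposite one.\<close>

lemma taylor_alternating:
  assumes l: "l < 0" and x: "0 \<le> x"
  shows "0 \<le> (- 1) ^ n * taylor b (sol_coeff b l) n x"
  using x
proof (induction n arbitrary: x rule: less_induct)
  case (less n)
  let ?T = "taylor b (sol_coeff b l)"
  let ?W = "\<lambda>n x. (- 1) ^ n * ?T n x"
  note a = entire_sol_coeff[OF b, of l]
  show ?case
  proof (rule ccontr)
    assume neg: "\<not> 0 \<le> ?W n x"
    have "continuous_on {0..} (?T n)"
      unfolding taylor_def by (intro continuous_on_powser entire_taylor a b)
    then have "continuous_on {0..x} (?W n)"
      by (intro continuous_intros) (rule continuous_on_subset, auto)
    then obtain z where z: "0 \<le> z" "z \<le> x" and min: "\<And>y. 0 \<le> y \<Longrightarrow> y \<le> x \<Longrightarrow> ?W n z \<le> ?W n y"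
      using continuous_attains_inf[of "{0..x}" "?W n"] less.prems by auto
    have Wz: "?W n z < 0" using min[of x] less.prems neg by simp
    \<comment> \<open>The value is 1 for \<open>n = 0\<close> and 0 otherwise, so a negative minimum
      lies at a positive point.\<close>
    have "0 \<le> ?W n 0"
      by (cases n) (simp_all add: taylor_def powser_0 sol_coeff_0)
    then have z0: "0 < z" using z Wz by (cases "z = 0") auto
    have "0 \<le> (LBINT s:{0<..<1}. levy_density b s * (?W n (z * s) - ?W n z))"
      unfolding set_lebesgue_integral_def
    proof (rule integral_nonneg_AE, rule AE_I2)
      fix s :: real
      show "0 \<le> indicator {0<..<1} s *\<^sub>R (levy_density b s * (?W n (z * s) - ?W n z))"
      proof (cases "s \<in> {0<..<1}")
        case True
        then have "z * s \<le> z * 1" using z by (intro mult_left_mono) auto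
        then have "?W n z \<le> ?W n (z * s)" using True z by (intro min) auto
        then show ?thesis using True levy_nonneg[OF b, of s] by simp
      qed simp
    qed
    also have "(LBINT s:{0<..<1}. levy_density b s * (?W n (z * s) - ?W n z)) =
      (LBINT s:{0<..<1}. (- ((- 1) ^ n)) * (levy_density b s * (?T n z - ?T n (z * s))))"
      by (intro set_integral_cong_on) (simp add: algebra_simps)
    also have "\<dots> = (- ((- 1) ^ n)) * (LBINT s:{0<..<1}. levy_density b s * (?T n z - ?T n (z * s)))"
      by (rule set_integral_mult_right)
    also have "(LBINT s:{0<..<1}. levy_density b s * (?T n z - ?T n (z * s))) =
      l * z powr b * (\<Sum>j=0..n. (b gchoose (n - j)) * ?T j z)"
      by (rule levy_taylor[OF z(1)])
    finally have le: "(l * z powr b) * ((- 1) ^ n * (\<Sum>j=0..n. (b gchoose (n - j)) * ?T j z)) \<le> 0"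
      by (simp add: mult_ac)
    have "(- 1) ^ n * (\<Sum>j=0..n. (b gchoose (n - j)) * ?T j z) =
      (\<Sum>j=0..n. ((- 1) ^ (n - j) * (b gchoose (n - j))) * ?W j z)"
      unfolding sum_distrib_left
    proof (rule sum.cong)
      fix j assume "j \<in> {0..n}"
      then have "(- 1 :: real) ^ n = (- 1) ^ (n - j) * (- 1) ^ j" by (simp add: power_add[symmetric])
      then show "(- 1) ^ n * ((b gchoose (n - j)) * ?T j z) = ((- 1) ^ (n - j) * (b gchoose (n - j))) * ?W j z"
        by (simp only: mult_ac)
    qed simp
    \<comment> \<open>The diagonal term has coefficient 1 and is strictly negative; the others pair
      nonpositive binomial signs with lower orders that are nonnegative by induction.\<close>
    also have "\<dots> = ?W n z + (\<Sum>j<n. ((- 1) ^ (n - j) * (b gchoose (n - j))) * ?W j z)"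
      by (simp add: atLeast0AtMost lessThan_Suc_atMost[symmetric])
    also have "(\<Sum>j<n. ((- 1) ^ (n - j) * (b gchoose (n - j))) * ?W j z) \<le> 0"
    proof (rule sum_nonpos)
      fix j assume "j \<in> {..<n}"
      then have "j < n" by simp
      then obtain k where k: "n - j = Suc k" by (metis Suc_diff_Suc)
      show "((- 1) ^ (n - j) * (b gchoose (n - j))) * ?W j z \<le> 0"
        unfolding k by (intro mult_nonpos_nonneg gbinomial_alternating_nonpos b less.IH z \<open>j < n\<close>)
    qed
    finally have "(- 1) ^ n * (\<Sum>j=0..n. (b gchoose (n - j)) * ?T j z) < 0" using Wz by simp
    moreover have "l * z powr b < 0" using l z0 by (simp add: mult_neg_pos)
    ultimately have "0 < (l * z powr b) * ((- 1) ^ n * (\<Sum>j=0..n. (b gchoose (n - j)) * ?T j z))"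
      by (rule mult_neg_neg[rotated])
    then show False using le by linarith
  qed
qed

end

subsection \<open>Decay\<close>

text \<open>For large \<open>r\<close> the factor \<open>r\<^sup>-\<^sup>\<beta> / \<Gamma>(1 - \<beta>) - k\<close> is below \<open>- k / 2\<close>, while the
  Riemann--Liouville integral, a primitive of its product with \<open>u\<close>, stays nonnegative.\<close>

lemma solution_integral_bounded:
  fixes u :: "real \<Rightarrow> real"
  assumes b: "0 < b" "b < 1" and k: "0 < k" and sol: "solution b (- k) u0 u"
    and bd: "\<And>x. 0 < x \<Longrightarrow> 0 \<le> u x \<and> u x \<le> u0"
  obtains A where "0 < A" "\<And>x. 0 < x \<Longrightarrow> (LBINT r:{0<..<x}. u r) \<le> A"
proof -
  let ?G = "Gamma (1 - b)"
  have G: "0 < ?G" using b by simp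
  have "((\<lambda>r::real. r powr (- b)) \<longlongrightarrow> 0) at_top" using b by real_asymp
  then have "((\<lambda>r. r powr (- b) / ?G) \<longlongrightarrow> 0) at_top" by (rule tendsto_divide_zero)
  then have "eventually (\<lambda>r. r powr (- b) / ?G < k / 2) at_top"
    by (rule order_tendstoD) (use k in simp)
  then obtain x1' where x1': "\<And>r. x1' \<le> r \<Longrightarrow> r powr (- b) / ?G < k / 2"
    by (auto simp: eventually_at_top_linorder)
  define x1 where "x1 = max 1 x1'"
  have x1: "0 < x1" "\<And>r. x1 \<le> r \<Longrightarrow> r powr (- b) / ?G < k / 2"
    using x1' by (auto simp: x1_def)
  \<comment> \<open>On \<open>(0, x1)\<close> the bound \<open>u <= u0\<close> is used; cutting off
    at \<open>x1\<close> makes the integral of this majorant independent of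
    \<open>x\<close>.\<close>
  let ?h = "\<lambda>r. r powr (- b) / ?G * u0"
  let ?g = "\<lambda>r. indicator {0<..<x1} r *\<^sub>R ?h r"
  have u0: "0 \<le> u0" using bd[of 1] by simp
  have ig: "integrable lborel ?g"
  proof -
    have "((\<lambda>r. r powr (- b)) has_integral (x1 powr (- b + 1) / (- b + 1))) {0..x1}"
      by (rule has_integral_powr_from_0) (use b x1 in auto)
    moreover have "continuous_on {0<..<x1} (\<lambda>r. r powr (- b))" by (intro continuous_intros) auto
    ultimately have "set_integrable lborel {0<..<x1} (\<lambda>r. r powr (- b))"
      by (rule set_lborel_of_has_integral_nonneg) simp
    then have "set_integrable lborel {0<..<x1} ?h"
      by (intro set_integrable_mult_left set_integrable_divide)
    then show ?thesis by (simp add: set_integrable_def)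
  qed
  have g0: "0 \<le> ?g r" for r using u0 G by simp
  have main: "(LBINT r:{0<..<x}. u r) \<le> 2 / k * (\<integral>r. ?g r \<partial>lborel)" if x: "0 < x" for x
  proof -
    let ?f = "\<lambda>r. (r powr (- b) / ?G + - k) * u r"
    have sx: "solves_on b (- k) u0 x u" using sol x by (simp add: solution_def)
    then have cu: "continuous_on {0..x} u" by (simp add: solves_on_def C_beta_Icc_def)
    have iu: "set_integrable lborel {0<..<x} u"
      by (rule set_integrable_subset[OF borel_integrable_atLeastAtMost'[OF cu]]) auto
    have if': "set_integrable lborel {0<..<x} ?f"
      by (rule forcing_integrable[OF b cu x]) simp
    have igx: "set_integrable lborel {0<..<x} ?g"
      unfolding set_integrable_def by (intro integrable_mult_indicator ig) simp
    have "0 \<le> RL_integral (1 - b) u x"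
      unfolding RL_integral_def set_lebesgue_integral_def
      by (rule integral_nonneg_AE) (use bd G in \<open>auto simp: indicator_def\<close>)
    also have "\<dots> = (LBINT r:{0<..<x}. ?f r)"
      by (rule solves_on_RL_integral[OF b sx x]) simp
    finally have f0: "0 \<le> (LBINT r:{0<..<x}. ?f r)" .
    have "k / 2 * (LBINT r:{0<..<x}. u r) = (LBINT r:{0<..<x}. k / 2 * u r)"
      by (rule set_integral_mult_right[symmetric])
    also have "\<dots> \<le> (LBINT r:{0<..<x}. ?g r - ?f r)"
    proof (rule set_integral_mono)
      show "set_integrable lborel {0<..<x} (\<lambda>r. k / 2 * u r)"
        by (intro set_integrable_mult_right iu)
      show "set_integrable lborel {0<..<x} (\<lambda>r. ?g r - ?f r)"
        by (intro set_integral_diff igx if')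
      fix r assume r: "r \<in> {0<..<x}"
      then have ur: "0 \<le> u r" "u r \<le> u0" using bd by auto
      \<comment> \<open>Before \<open>x1\<close> the positive part of \<open>?f\<close> is absorbed
        by \<open>?g\<close>; after \<open>x1\<close>, where \<open>?g\<close> vanishes, the
        coefficient in \<open>?f\<close> is at most \<open>- k / 2\<close>.\<close>
      show "k / 2 * u r \<le> ?g r - ?f r"
      proof (cases "r < x1")
        case True
        define p where "p = r powr (- b) / ?G"
        have "p * u r \<le> p * u0"
          unfolding p_def using ur G by (intro mult_left_mono) auto
        moreover have "0 \<le> k * u r" using ur k by simp
        ultimately show ?thesis using True r by (simp add: p_def[symmetric] algebra_simps)
      next
        case False
        define p where "p = r powr (- b) / ?G"
        have "p * u r \<le> k / 2 * u r"
          unfolding p_def using x1(2)[of r] ur False by (intro mult_right_mono) auto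
        then show ?thesis using False by (simp add: p_def[symmetric] algebra_simps)
      qed
    qed
    also have "\<dots> = (LBINT r:{0<..<x}. ?g r) - (LBINT r:{0<..<x}. ?f r)"
      by (rule set_integral_diff(2)[OF igx if'])
    also have "\<dots> \<le> (LBINT r:{0<..<x}. ?g r)" using f0 by simp
    also have "\<dots> \<le> (\<integral>r. ?g r \<partial>lborel)"
      unfolding set_lebesgue_integral_def
      by (rule integral_mono[OF igx[unfolded set_integrable_def] ig]) (use u0 G in \<open>auto simp: indicator_def\<close>)
    finally have "2 / k * (k / 2 * (LBINT r:{0<..<x}. u r)) \<le> 2 / k * (\<integral>r. ?g r \<partial>lborel)"
      by (rule mult_left_mono) (use k in simp)
    moreover have "2 / k * (k / 2 * (LBINT r:{0<..<x}. u r)) = (LBINT r:{0<..<x}. u r)"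
      using k by simp
    ultimately show ?thesis by (simp only:)
  qed
  have "0 \<le> (\<integral>r. ?g r \<partial>lborel)" by (rule integral_nonneg_AE) (use g0 in auto)
  then have "0 < 2 / k * (\<integral>r. ?g r \<partial>lborel) + 1" using k by (intro add_nonneg_pos mult_nonneg_nonneg) auto
  then show ?thesis by (rule that) (use main in force)
qed

text \<open>By convexity the descent on \<open>[y, x]\<close> is no steeper than the mean descent
  over \<open>[x/4, x/2]\<close>, which is at most \<open>u (x / 4)\<close> divided by the length
  \<open>x / 4\<close>.\<close>

lemma convex_decreasing_increment:
  fixes u u' :: "real \<Rightarrow> real"
  assumes der: "\<And>x. 0 < x \<Longrightarrow> (u has_real_derivative u' x) (at x)"
    and mono: "\<And>x y. 0 < x \<Longrightarrow> x \<le> y \<Longrightarrow> u' x \<le> u' y"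
    and nonneg: "\<And>x. 0 < x \<Longrightarrow> 0 \<le> u x"
    and y: "0 < x" "x / 2 \<le> y" "y \<le> x"
  shows "u y - u x \<le> (x - y) * (4 / x) * u (x / 4)"
proof (cases "y = x")
  case False
  then have "\<exists>z>y. z < x \<and> u x - u y = (x - y) * u' z"
    using y by (intro MVT2 der) auto
  then obtain z where z: "y < z" "z < x" "u x - u y = (x - y) * u' z" by blast
  have "\<exists>w>x / 4. w < x / 2 \<and> u (x / 2) - u (x / 4) = (x / 2 - x / 4) * u' w"
    using y by (intro MVT2 der) auto
  then obtain w where w: "x / 4 < w" "w < x / 2" "u (x / 2) - u (x / 4) = (x / 2 - x / 4) * u' w" by blast
  have "u' w = (4 / x) * (u (x / 2) - u (x / 4))" using w(3) y by (simp add: field_simps)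
  moreover have "u' w \<le> u' z" using w z y by (intro mono) auto
  moreover have "(4 / x) * u (x / 2) \<ge> 0" using nonneg[of "x / 2"] y by simp
  ultimately have "- u' z \<le> (4 / x) * u (x / 4)" by (simp add: right_diff_distrib)
  then have "(x - y) * (- u' z) \<le> (x - y) * ((4 / x) * u (x / 4))"
    using y by (intro mult_left_mono) auto
  then show ?thesis using z(3) by (simp add: algebra_simps)
qed simp

text \<open>Near \<open>s = 1\<close> convexity makes the singular kernel integrable, and elsewhere
  the integral bound on \<open>u\<close> suffices.\<close>

lemma levy_equation_upper:
  fixes u u' :: "real \<Rightarrow> real"
  assumes b: "0 < b" "b < 1" and k: "0 < k" and A: "0 < A"
    and cont: "continuous_on {0..} u"
    and der: "\<And>x. 0 < x \<Longrightarrow> (u has_real_derivative u' x) (at x)"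
    and mono: "\<And>x y. 0 < x \<Longrightarrow> x \<le> y \<Longrightarrow> u' x \<le> u' y"
    and nonneg: "\<And>x. 0 \<le> x \<Longrightarrow> 0 \<le> u x"
    and decr: "\<And>x y. 0 \<le> x \<Longrightarrow> x \<le> y \<Longrightarrow> u y \<le> u x"
    and intA: "\<And>x. 0 < x \<Longrightarrow> (LBINT r:{0<..<x}. u r) \<le> A"
    and levy_density: "\<And>x. 0 < x \<Longrightarrow> set_integrable lborel {0<..<1} (\<lambda>s. levy_density b s * (u (x * s) - u x))"
    and eq: "\<And>x. 0 < x \<Longrightarrow> (LBINT s:{0<..<1}. levy_density b s * (u (x * s) - u x)) = k * x powr b * u x"
  obtains C where "0 < C" "\<And>x. 0 < x \<Longrightarrow> u x \<le> C / x powr (1 + b)"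
proof -
  let ?c = "b / Gamma (1 - b)"
  have c: "0 < ?c" using b by simp
  have q: "0 < 1 - b" using b by simp
  let ?p = "\<lambda>s::real. s powr (1 - 1) * (1 - s) powr ((1 - b) - 1)"
  note P = set_lborel_Beta[OF zero_less_one q]
  let ?M = "Beta 1 (1 - b)"
  have M: "0 < ?M" using b by (simp add: Beta_eq_Gamma_div)
  have I: "set_integrable lborel {0<..<1} (\<lambda>s. u (x * s))" "(LBINT s:{0<..<1}. u (x * s)) \<le> A / x" if x: "0 < x" for x
  proof -
    have "set_integrable lborel {0..1} (\<lambda>s. u (x * s))"
      by (rule borel_integrable_atLeastAtMost', rule continuous_on_compose2[OF cont])
         (use x in \<open>auto intro!: continuous_intros\<close>)
    then show "set_integrable lborel {0<..<1} (\<lambda>s. u (x * s))"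
      by (rule set_integrable_subset) auto
    have "x * (LBINT s:{0<..<1}. u (x * s)) \<le> A"
      using set_lborel_scale(1)[OF x, of 0 u] intA[OF x] by simp
    then show "(LBINT s:{0<..<1}. u (x * s)) \<le> A / x" using x by (simp add: field_simps)
  qed
  have ux: "u x \<le> A / x" if x: "0 < x" for x
  proof -
    have "u x = (LBINT s:{0<..<1::real}. u x)" by (simp add: set_lebesgue_integral_def)
    also have "\<dots> \<le> (LBINT s:{0<..<1}. u (x * s))"
    proof (rule set_integral_mono)
      show "set_integrable lborel {0<..<1::real} (\<lambda>s. u x)"
        by (rule set_integrable_subset[OF borel_integrable_atLeastAtMost'[of 0 1, OF continuous_on_const]]) auto
      show "set_integrable lborel {0<..<1} (\<lambda>s. u (x * s))" by (rule I(1)[OF x])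
      fix s :: real assume s: "s \<in> {0<..<1}"
      then have "x * s \<le> x * 1" using x by (intro mult_left_mono) auto
      then show "u x \<le> u (x * s)" using s x by (intro decr) auto
    qed
    also have "\<dots> \<le> A / x" by (rule I(2)[OF x])
    finally show ?thesis .
  qed
  \<comment> \<open>For \<open>s <= 1/2\<close> the 4 bounds \<open>(1 - s)^(-1-b)\<close>, as
    \<open>1 + b <= 2\<close>. For \<open>s > 1/2\<close> the 16 is the slope factor
    \<open>4 / x\<close> times \<open>u (x / 4) <= 4 A / x\<close>, and \<open>?M\<close> is the
    integral of \<open>(1 - s)^(-b)\<close>.\<close>
  define C where "C = ?c * A * (4 + 16 * ?M) / k"
  have "u x \<le> C / x powr (1 + b)" if x: "0 < x" for x
  proof -
    have pt: "levy_density b s * (u (x * s) - u x) \<le> ?c * 4 * u (x * s) + ?c * (16 * A / x) * ?p s"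
      if s: "s \<in> {0<..<1}" for s
    proof (cases "s \<le> 1 / 2")
      case True
      have "(1 - s) powr (- 1 - b) \<le> (1 / 2) powr (- 1 - b)"
        by (rule powr_mono2') (use True b in auto)
      also have "\<dots> \<le> (1 / 2) powr (- 2)"
        by (rule powr_mono') (use b in auto)
      also have "\<dots> = 4" by (simp add: powr_minus powr_numeral power2_eq_square)
      finally have "levy_density b s \<le> ?c * 4" unfolding levy_density_def using c by (intro mult_left_mono) auto
      moreover have "u (x * s) - u x \<le> u (x * s)" using nonneg[of x] x by simp
      moreover have "0 \<le> u (x * s)" using s x by (intro nonneg) auto
      moreover have "0 \<le> levy_density b s" by (rule levy_nonneg[OF b])
      ultimately have "levy_density b s * (u (x * s) - u x) \<le> ?c * 4 * u (x * s)"
        using c by (meson mult_left_mono mult_right_mono order_trans)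
      moreover have "0 \<le> ?c * (16 * A / x) * ?p s" using c A x by (intro mult_nonneg_nonneg) auto
      ultimately show ?thesis by linarith
    next
      case False
      have xs: "x * s \<le> x * 1" "x * (1 / 2) \<le> x * s" using s x False by (intro mult_left_mono; simp)+
      have "u (x * s) - u x \<le> (x - x * s) * (4 / x) * u (x / 4)"
        by (rule convex_decreasing_increment[OF der mono nonneg]) (use x xs in auto)
      also have "\<dots> \<le> (x - x * s) * (4 / x) * (A / (x / 4))"
        using xs x by (intro mult_left_mono ux mult_nonneg_nonneg) auto
      also have "\<dots> = (16 * A / x) * (1 - s)" using x by (simp add: field_simps)
      finally have "levy_density b s * (u (x * s) - u x) \<le> levy_density b s * ((16 * A / x) * (1 - s))"
        by (intro mult_left_mono levy_nonneg[OF b])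
      also have "\<dots> = ?c * (16 * A / x) * ((1 - s) powr (- 1 - b) * (1 - s))"
        by (simp add: levy_density_def mult_ac)
      also have "(1 - s) powr (- 1 - b) * (1 - s) = ?p s"
        using s powr_mult_base[of "1 - s" "- 1 - b"] by (simp add: mult.commute)
      finally have "levy_density b s * (u (x * s) - u x) \<le> ?c * (16 * A / x) * ?p s" .
      moreover have "0 \<le> ?c * 4 * u (x * s)" using c s x by (intro mult_nonneg_nonneg nonneg) auto
      ultimately show ?thesis by linarith
    qed
    have i1: "set_integrable lborel {0<..<1} (\<lambda>s. ?c * 4 * u (x * s))"
      and i2: "set_integrable lborel {0<..<1} (\<lambda>s. ?c * (16 * A / x) * ?p s)"
      by (intro set_integrable_mult_right I x P)+
    have "k * x powr b * u x = (LBINT s:{0<..<1}. levy_density b s * (u (x * s) - u x))" using eq[OF x] by simp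
    also have "\<dots> \<le> (LBINT s:{0<..<1}. ?c * 4 * u (x * s) + ?c * (16 * A / x) * ?p s)"
      by (intro set_integral_mono levy_density[OF x] pt set_integral_add i1 i2)
    also have "\<dots> = ?c * 4 * (LBINT s:{0<..<1}. u (x * s)) + ?c * (16 * A / x) * ?M"
      unfolding set_integral_add(2)[OF i1 i2] set_integral_mult_right P(2) ..
    also have "\<dots> \<le> ?c * 4 * (A / x) + ?c * (16 * A / x) * ?M"
      by (intro add_right_mono mult_left_mono I x) (use b in simp)
    also have "\<dots> = ?c * A * (4 + 16 * ?M) / x" by (simp add: algebra_simps add_divide_distrib)
    also have "\<dots> = k * (C / x)" using k by (simp add: C_def)
    finally have "x powr b * u x \<le> C / x" using k by (simp only: mult.assoc mult_le_cancel_left_pos)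
    then show ?thesis using x by (simp add: powr_add field_simps)
  qed
  moreover have "0 < C" unfolding C_def using b A M k by (intro divide_pos_pos mult_pos_pos add_pos_pos) auto
  ultimately show ?thesis using that by blast
qed

text \<open>Only \<open>s < h / x\<close> is kept: there \<open>x s <= h\<close>, so the increment
  is at least the fixed gap \<open>u h - u 1\<close>, and the length \<open>h / x\<close> of this
  range produces the factor 1/x.\<close>

lemma levy_equation_lower:
  fixes u :: "real \<Rightarrow> real"
  assumes b: "0 < b" "b < 1" and k: "0 < k" and "0 < u 0"
    and cont: "continuous_on {0..} u"
    and decr: "\<And>x y. 0 \<le> x \<Longrightarrow> x \<le> y \<Longrightarrow> u y \<le> u x"
    and levy_density: "\<And>x. 0 < x \<Longrightarrow> set_integrable lborel {0<..<1} (\<lambda>s. levy_density b s * (u (x * s) - u x))"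
    and eq: "\<And>x. 0 < x \<Longrightarrow> (LBINT s:{0<..<1}. levy_density b s * (u (x * s) - u x)) = k * x powr b * u x"
  obtains C where "0 < C" "\<And>x. 1 \<le> x \<Longrightarrow> C / x powr (1 + b) \<le> u x"
proof -
  let ?c = "b / Gamma (1 - b)"
  have c: "0 < ?c" using b by simp
  \<comment> \<open>If \<open>u\<close> were constant on \<open>(0, 1]\<close>, the equation at
    \<open>x = 1\<close> would force the constant to be 0, and \<open>u\<close> would jump from
    \<open>u 0 > 0\<close> down to 0.\<close>
  have "\<exists>h\<in>{0<..<1}. u 1 < u h"
  proof (rule ccontr)
    assume "\<not> ?thesis"
    then have const: "u h = u 1" if "h \<in> {0<..<1}" for h
      using that decr[of h 1] by force
    have "(LBINT s:{0<..<1}. levy_density b s * (u (1 * s) - u 1)) = (LBINT s:{0<..<1}. 0 * levy_density b s)"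
      by (rule set_integral_cong_on) (simp add: const)
    then have "u 1 = 0" using eq[of 1] k by simp
    moreover have "\<exists>y\<ge>0. y \<le> 1 \<and> u y = u 0 / 2"
      by (rule IVT2') (use \<open>0 < u 0\<close> \<open>u 1 = 0\<close> continuous_on_subset[OF cont] in auto)
    then obtain y where y: "0 \<le> y" "y \<le> 1" "u y = u 0 / 2" by blast
    ultimately show False
      using const[of y] \<open>0 < u 0\<close> by (cases "y = 0"; cases "y = 1") auto
  qed
  then obtain h where h: "0 < h" "h < 1" "u 1 < u h" by auto
  let ?d = "u h - u 1"
  have "?c * ?d * h / k / x powr (1 + b) \<le> u x" if x: "1 \<le> x" for x
  proof -
    have hx: "0 < h / x" "h / x < 1" using h x by auto
    have i: "set_integrable lborel {0<..<1} (\<lambda>s. ?c * ?d * indicator {0<..<h / x} s)"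
      unfolding set_integrable_def
      by (intro integrable_mult_indicator integrable_mult_right integrable_real_indicator) (use hx in auto)
    have "?c * ?d * (h / x) = ?c * ?d * (LBINT s:{0<..<1}. indicator {0<..<h / x} s)"
    proof -
      have "{0<..<1} \<inter> {0<..<h / x} = {0<..<h / x}" using hx by auto
      then have "(LBINT s:{0<..<1}. indicator {0<..<h / x} s) = measure lborel {0<..<h / x}"
        by (simp add: set_lebesgue_integral_def indicator_inter_arith[symmetric])
      then show ?thesis using hx by simp
    qed
    also have "\<dots> = (LBINT s:{0<..<1}. ?c * ?d * indicator {0<..<h / x} s)"
      by (rule set_integral_mult_right[symmetric])
    also have "\<dots> \<le> (LBINT s:{0<..<1}. levy_density b s * (u (x * s) - u x))"
    proof (rule set_integral_mono[OF i levy_density])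
      fix s :: real assume s: "s \<in> {0<..<1}"
      have "x * s \<le> x * 1" using s x by (intro mult_left_mono) auto
      then have nn: "0 \<le> u (x * s) - u x" using s x by (simp add: decr)
      show "?c * ?d * indicator {0<..<h / x} s \<le> levy_density b s * (u (x * s) - u x)"
      proof (cases "s < h / x")
        case True
        then have "x * s \<le> h" using x by (simp add: field_simps)
        then have "u h \<le> u (x * s)" using s x by (intro decr) auto
        moreover have "u x \<le> u 1" using x by (intro decr) auto
        ultimately have "?c * ?d \<le> levy_density b s * (u (x * s) - u x)"
          using levy_ge[OF b s] levy_nonneg[OF b, of s] h c by (intro mult_mono) auto
        then show ?thesis using True s by simp
      next
        case False
        then show ?thesis using nn levy_nonneg[OF b, of s] by simp
      qed
    qed (use x in auto)
    also have "\<dots> = k * x powr b * u x" by (rule eq) (use x in auto)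
    finally have "?c * ?d * (h / x) / (k * x powr b) \<le> k * x powr b * u x / (k * x powr b)"
      by (rule divide_right_mono) (use k in simp)
    then show ?thesis using x k by (simp add: powr_add mult_ac)
  qed
  moreover have "0 < ?c * ?d * h / k" using b h k by (intro divide_pos_pos mult_pos_pos) auto
  ultimately show ?thesis using that by blast
qed

theorem theorem3p17:
  fixes \<beta> lam u0 :: real and u :: "real \<Rightarrow> real"
  assumes "0 < \<beta>" and "\<beta> < 1" and "lam < 0" and "u0 > 0"
    and "solution \<beta> lam u0 u"
  shows "completely_monotone u \<and>
    (\<exists>C>1. \<forall>x\<ge>1. inverse C / x powr (1 + \<beta>) \<le> u x \<and> u x \<le> C / x powr (1 + \<beta>))"
proof
  note b = assms(1,2)
  let ?a = "sol_coeff \<beta> lam"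
  let ?T = "taylor \<beta> ?a"
  note a = entire_sol_coeff[OF b, of lam]
  have u: "u x = u0 * powser \<beta> ?a x" if "0 \<le> x" for x
    using solution_eq_series[OF b assms(5) that] by (simp add: sol_series_powser)
  have D: "(deriv ^^ n) u x = u0 * (fact n * ?T n x / x ^ n)"
    "((deriv ^^ n) u has_real_derivative u0 * (fact (Suc n) * ?T (Suc n) x / x ^ Suc n)) (at x)"
    if "0 < x" for n x
    by (rule deriv_iterate_powser[OF a _ that]; use u in simp)+
  have alt: "0 \<le> (- 1) ^ n * (u0 * (fact n * ?T n x / x ^ n))" if "0 < x" for n x
  proof -
    have "(- 1) ^ n * (u0 * (fact n * ?T n x / x ^ n)) = u0 * fact n / x ^ n * ((- 1) ^ n * ?T n x)"
      by simp
    also have "0 \<le> \<dots>"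
      by (rule mult_nonneg_nonneg[OF _ taylor_alternating[OF b assms(3)]]) (use that assms(4) in auto)
    finally show ?thesis .
  qed
  show "completely_monotone u"
    unfolding completely_monotone_def
  proof (intro allI impI conjI)
    fix n :: nat and x :: real
    assume x: "0 < x"
    show "(deriv ^^ n) u field_differentiable at x"
      unfolding field_differentiable_def using D(2)[OF x] by blast
    show "0 \<le> (- 1) ^ n * (deriv ^^ n) u x"
      unfolding D(1)[OF x] by (rule alt[OF x])
  qed
  have cont: "continuous_on {0..} u"
    by (subst continuous_on_cong[OF refl u])
       (auto intro!: continuous_intros continuous_on_powser a b)
  have nonneg: "0 \<le> u x" if "0 \<le> x" for x
    using taylor_alternating[OF b assms(3) that, of 0] assms(4) that by (simp add: u taylor_0)
  have der: "(u has_real_derivative deriv u x) (at x)" if x: "0 < x" for x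
    using D(2)[OF x, of 0] by (metis DERIV_imp_deriv funpow_0)
  have der0: "deriv u x \<le> 0" if x: "0 < x" for x
    using D(1)[OF x, of 1] alt[OF x, of 1] by simp
  have decr: "u y \<le> u x" if "0 \<le> x" "x \<le> y" for x y
  proof (rule DERIV_nonpos_imp_decreasing_open[OF that(2)])
    show "\<exists>d. (u has_real_derivative d) (at z) \<and> d \<le> 0" if "x < z" "z < y" for z
      using der[of z] der0[of z] that \<open>0 \<le> x\<close> by auto
    show "continuous_on {x..y} u" by (rule continuous_on_subset[OF cont]) (use that in auto)
  qed
  have convex: "deriv u x \<le> deriv u y" if "0 < x" "x \<le> y" for x y
  proof (rule DERIV_nonneg_imp_nondecreasing[OF that(2)])
    fix z assume "x \<le> z" "z \<le> y"
    then have z: "0 < z" using that by simp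
    show "\<exists>d. (deriv u has_real_derivative d) (at z) \<and> 0 \<le> d"
      using D(2)[OF z, of 1] alt[OF z, of 2] by (auto simp: numeral_2_eq_2)
  qed
  have u_0: "u 0 = u0" using u[of 0] by (simp add: powser_0 sol_coeff_0)
  have flip: "levy_density \<beta> s * (u (x * s) - u x) = - u0 * (levy_density \<beta> s * (powser \<beta> ?a x - powser \<beta> ?a (x * s)))"
    if "s \<in> {0<..<1}" "0 < x" for s x
    using that by (simp add: u algebra_simps)
  have levy_density: "set_integrable lborel {0<..<1} (\<lambda>s. levy_density \<beta> s * (u (x * s) - u x))" if x: "0 < x" for x
    by (subst set_integrable_cong[OF refl refl flip[OF _ x]], assumption)
       (intro set_integrable_mult_right powser_levy(1) b a less_imp_le[OF x])
  have eq: "(LBINT s:{0<..<1}. levy_density \<beta> s * (u (x * s) - u x)) = - lam * x powr \<beta> * u x" if x: "0 < x" for x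
  proof -
    have "(LBINT s:{0<..<1}. levy_density \<beta> s * (u (x * s) - u x)) =
      - u0 * (LBINT s:{0<..<1}. levy_density \<beta> s * (powser \<beta> ?a x - powser \<beta> ?a (x * s)))"
      by (subst set_integral_cong_on[OF flip[OF _ x]], assumption) (rule set_integral_mult_right)
    then show ?thesis
      using levy_taylor[OF b less_imp_le[OF x], of lam 0] x by (simp add: taylor_0 u)
  qed
  have k: "0 < - lam" using assms(3) by simp
  obtain A where A: "0 < A" "\<And>x. 0 < x \<Longrightarrow> (LBINT r:{0<..<x}. u r) \<le> A"
    using solution_integral_bounded[OF b k, of u0 u] assms(5) nonneg decr[of 0] u_0 by auto
  obtain C where C: "0 < C" "\<And>x. 0 < x \<Longrightarrow> u x \<le> C / x powr (1 + \<beta>)"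
    using levy_equation_upper[OF b k A(1) cont der convex nonneg decr A(2) levy_density eq] by blast
  have "0 < u 0" using u_0 assms(4) by simp
  then obtain c where c: "0 < c" "\<And>x. 1 \<le> x \<Longrightarrow> c / x powr (1 + \<beta>) \<le> u x"
    using levy_equation_lower[OF b k _ cont decr levy_density eq] by blast
  \<comment> \<open>The summands ensure in turn \<open>?K > 1\<close>, \<open>?K >= C\<close> and
    \<open>inverse ?K <= c\<close>.\<close>
  let ?K = "1 + C + 1 / c"
  have K: "1 < ?K" using C c by (simp add: add_pos_pos)
  have "1 / c \<le> ?K" using C by simp
  then have Kc: "inverse ?K \<le> c" using le_imp_inverse_le[of "1 / c" ?K] c by simp
  have CK: "C \<le> ?K" using c by simp
  show "\<exists>C>1. \<forall>x\<ge>1. inverse C / x powr (1 + \<beta>) \<le> u x \<and> u x \<le> C / x powr (1 + \<beta>)"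
  proof (intro exI[of _ ?K] conjI K allI impI)
    fix x :: real assume x: "1 \<le> x"
    have "inverse ?K / x powr (1 + \<beta>) \<le> c / x powr (1 + \<beta>)" using Kc by (rule divide_right_mono) simp
    then show "inverse ?K / x powr (1 + \<beta>) \<le> u x" using c(2)[OF x] by simp
    have "C / x powr (1 + \<beta>) \<le> ?K / x powr (1 + \<beta>)" using CK by (rule divide_right_mono) simp
    then show "u x \<le> ?K / x powr (1 + \<beta>)" using C(2)[of x] x by simp
  qed
qed

end
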